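(* Let $X \subset \mathbb{R}^n$ be a closed semi-algebraic set and let $G \colon X \to \mathbb{R}^m$ be a continuous semi-algebraic mapping. Then the set $$\{F\in L(\mathbb{R}^n, \mathbb{R}^m) \ : \ (F + G)(X) \text{ is closed in } \mathbb{R}^m\}$$ is semi-algebraic and contains an open dense semi-algebraic subset of $L(\mathbb{R}^n, \mathbb{R}^m)$.
   Context: $L(\mathbb{R}^n,\mathbb{R}^m)$ denotes the space of all linear mappings $\mathbb{R}^n\to\mathbb{R}^m$, identified with $\mathbb{R}^{m\times n}$ via matrices in the canonical bases (so semi-algebraicity, openness and density refer to this identification). For $F \in L(\mathbb{R}^n,\mathbb{R}^m)$, $(F+G)(X) = \{F(x)+G(x) : x \in X\}$. A subset of $\mathbb{R}^N$ is semi-algebraic if it is a finite union of sets of the form $\{x : f(x)=0,\ g_1(x)>0,\dots,g_k(x)>0\}$ with $f,g_i$ polynomials; a mapping between semi-algebraic sets is semi-algebraic if its graph is semi-algebraic. *)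

theory Defs
  imports "HOL-Analysis.Analysis"
begin

inductive_set poly_fun :: "('a::euclidean_space \<Rightarrow> real) set" where
  const: "(\<lambda>x. c) \<in> poly_fun"
| coord: "b \<in> Basis \<Longrightarrow> (\<lambda>x. x \<bullet> b) \<in> poly_fun"
| add: "p \<in> poly_fun \<Longrightarrow> q \<in> poly_fun \<Longrightarrow> (\<lambda>x. p x + q x) \<in> poly_fun"
| mult: "p \<in> poly_fun \<Longrightarrow> q \<in> poly_fun \<Longrightarrow> (\<lambda>x. p x * q x) \<in> poly_fun"

definition basic_semialgebraic :: "'a::euclidean_space set \<Rightarrow> bool" where
  "basic_semialgebraic S \<longleftrightarrow>
     (\<exists>f gs. f \<in> poly_fun \<and> (\<forall>g\<in>set gs. g \<in> poly_fun) \<and>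
        S = {x. f x = 0 \<and> (\<forall>g\<in>set gs. g x > 0)})"

definition semialgebraic :: "'a::euclidean_space set \<Rightarrow> bool" where
  "semialgebraic S \<longleftrightarrow>
     (\<exists>\<A>. finite \<A> \<and> (\<forall>A\<in>\<A>. basic_semialgebraic A) \<and> S = \<Union>\<A>)"

definition semialgebraic_map ::
    "'a::euclidean_space set \<Rightarrow> ('a \<Rightarrow> 'b::euclidean_space) \<Rightarrow> bool" where
  "semialgebraic_map X G \<longleftrightarrow> semialgebraic {(x, G x) | x. x \<in> X}"

end

theory Submission
  imports Defs "HOL-Computational_Algebra.Polynomial" "HOL-Library.Multiset"
begin

text \<open>
  Closedness of the image is a first-order condition on \<open>F\<close>, so the first claim is an instance of
  the Tarski--Seidenberg theorem. For the second claim, put \<open>Y\<close> for the graph of \<open>G\<close>, a closed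
  semialgebraic set. The image \<open>(F + G)(X)\<close> is closed as soon as \<open>Y + V\<close> is closed, where
  \<open>V\<close> is the kernel of \<open>(x, y) \<mapsto> F x + y\<close>, and \<open>V\<close> can be added one line at a time.
  So let \<open>Y\<close> be closed and semialgebraic. Its frontier lies in the zero set of a nonzero
  polynomial \<open>f\<close>. If the leading form of \<open>f\<close> does not vanish at \<open>v\<close>, then projecting the
  frontier along \<open>v\<close> is a proper map; hence a line parallel to \<open>v\<close> that misses \<open>Y\<close> has a
  neighbourhood, consisting of parallel lines, that misses the frontier, and by connectedness this
  neighbourhood misses \<open>Y\<close>. Thus \<open>Y + \<real>v\<close> is closed for all \<open>v\<close> outside a proper algebraic
  set, and the good \<open>F\<close> are dense. A dense semialgebraic set contains the complement of a proper
  algebraic set.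
\<close>

section \<open>Signs of univariate polynomials\<close>

text \<open>Using the frontier is forced by the induction over the lines: even if \<open>Y\<close>
  is thin, \<open>Y + \<real>v\<close> may have interior points, and then no nonzero polynomial
  vanishes on it. The induction must also keep the sum semialgebraic, so it rests on the same
  elimination of one real variable as the first claim. That elimination is proved in a uniform form:
  if finitely many polynomials have the same signs at two parameters, then the univariate
  polynomials attached to these parameters have the same sign diagrams, and a witness on one line is
  carried over to the other. The passage between \<open>V\<close> and \<open>F\<close> works because
  the kernel is the graph of \<open>- F\<close>, spanned by the vectors
  \<open>(e_i, - F e_i)\<close>. Directions close to these again span the graph of a linear map
  close to \<open>- F\<close>. So it suffices to perturb directions in the product space, one after
  the other. The image is the slice of \<open>Y + V\<close> over the first coordinate 0, which is
  why closedness of the sum passes to it.\<close>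

lemma sgn_poly_eq_if_no_root:
  fixes p :: "real poly"
  assumes "\<And>r. t \<le> r \<Longrightarrow> r \<le> u \<Longrightarrow> poly p r \<noteq> 0" and "t \<le> u"
  shows "sgn (poly p t) = sgn (poly p u)"
proof (rule ccontr)
  assume ne: "sgn (poly p t) \<noteq> sgn (poly p u)"
  then have "t < u" using \<open>t \<le> u\<close> by (cases "t = u") auto
  moreover have "poly p t \<noteq> 0" "poly p u \<noteq> 0" using assms by auto
  with ne have "poly p t * poly p u < 0"
    by (auto simp: sgn_if mult_less_0_iff split: if_splits)
  ultimately show False using poly_IVT[of t u p] assms(1) by (meson less_imp_le)
qed

text \<open>Both signs are eventually that of the leading coefficient, which \<open>pderiv\<close>
  multiplies by the positive degree.\<close>

lemma sgn_poly_eventually_sgn_pderiv: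
  fixes p :: "real poly"
  assumes "degree p > 0"
  shows "\<exists>n. \<forall>t\<ge>n. sgn (poly p t) = sgn (poly (pderiv p) t)"
proof -
  have pos: "\<exists>n. \<forall>t\<ge>n. sgn (poly p t) = sgn (poly (pderiv p) t)"
    if p: "degree p > 0" "lead_coeff p > 0" for p :: "real poly"
  proof -
    have "lead_coeff (pderiv p) > 0"
      using p by (simp add: coeff_pderiv degree_pderiv)
    then obtain n1 n2 where "\<forall>t\<ge>n1. lead_coeff p \<le> poly p t"
        "\<forall>t\<ge>n2. lead_coeff (pderiv p) \<le> poly (pderiv p) t"
      using poly_pinfty_gt_lc p(2) by meson
    then have "\<forall>t\<ge>max n1 n2. poly p t > 0 \<and> poly (pderiv p) t > 0"
      using \<open>lead_coeff (pderiv p) > 0\<close> p(2) by fastforce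
    then show ?thesis by (intro exI[of _ "max n1 n2"]) (auto simp: sgn_if)
  qed
  show ?thesis
  proof (cases "lead_coeff p > 0")
    case True
    then show ?thesis using pos assms by blast
  next
    case False
    have "lead_coeff p \<noteq> 0" using assms by auto
    then have "lead_coeff p < 0" using False by linarith
    then have "\<exists>n. \<forall>t\<ge>n. sgn (poly (- p) t) = sgn (poly (pderiv (- p)) t)"
      using assms by (intro pos) auto
    then show ?thesis by (simp add: pderiv_minus sgn_minus)
  qed
qed

lemma sgn_poly_plus_infinity:
  fixes p :: "real poly"
  assumes "degree p > 0"
    and "\<And>r. t \<le> r \<Longrightarrow> poly p r \<noteq> 0" and "\<And>r. t \<le> r \<Longrightarrow> poly (pderiv p) r \<noteq> 0"
  shows "sgn (poly p t) = sgn (poly (pderiv p) t)"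
proof -
  obtain n where n: "\<forall>t\<ge>n. sgn (poly p t) = sgn (poly (pderiv p) t)"
    using sgn_poly_eventually_sgn_pderiv assms(1) by blast
  define u where "u = max n t"
  have "sgn (poly p t) = sgn (poly p u)" "sgn (poly (pderiv p) t) = sgn (poly (pderiv p) u)"
    using assms by (auto intro!: sgn_poly_eq_if_no_root simp: u_def)
  then show ?thesis using n by (simp add: u_def)
qed

lemma sgn_poly_minus_infinity:
  fixes p :: "real poly"
  assumes "degree p > 0"
    and "\<And>r. r \<le> t \<Longrightarrow> poly p r \<noteq> 0" and "\<And>r. r \<le> t \<Longrightarrow> poly (pderiv p) r \<noteq> 0"
  shows "sgn (poly p t) = - sgn (poly (pderiv p) t)"
proof -
  let ?q = "pcompose p [:0, -1:]"
  have d: "poly (pderiv ?q) r = - poly (pderiv p) (- r)" for r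
    by (simp add: pderiv_pcompose poly_pcompose pderiv_pCons)
  have "sgn (poly ?q (- t)) = sgn (poly (pderiv ?q) (- t))"
    by (rule sgn_poly_plus_infinity)
       (use assms in \<open>auto simp: d poly_pcompose degree_pcompose\<close>)
  then show ?thesis by (simp add: d poly_pcompose sgn_minus)
qed

text \<open>The end point \<open>a\<close> will be a cut point of a cell decomposition, so it may be
  a root; the mean value theorem then leaves the sign to the derivative.\<close>

lemma sgn_poly_right_of:
  fixes p :: "real poly"
  assumes "a < t"
    and "\<And>r. a < r \<Longrightarrow> r \<le> t \<Longrightarrow> poly p r \<noteq> 0"
    and "\<And>r. a < r \<Longrightarrow> r \<le> t \<Longrightarrow> poly (pderiv p) r \<noteq> 0"
  shows "sgn (poly p t) = (if poly p a = 0 then sgn (poly (pderiv p) t) else sgn (poly p a))"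
proof (cases "poly p a = 0")
  case True
  obtain x where x: "a < x" "x < t" "poly p t - poly p a = (t - a) * poly (pderiv p) x"
    using poly_MVT assms(1) by blast
  then have "sgn (poly p t) = sgn (poly (pderiv p) x)"
    using True by (simp add: sgn_mult)
  also have "\<dots> = sgn (poly (pderiv p) t)"
    using x assms by (intro sgn_poly_eq_if_no_root) auto
  finally show ?thesis using True by simp
next
  case False
  then have "poly p r \<noteq> 0" if "a \<le> r" "r \<le> t" for r
    using that assms(2) by (cases "r = a") auto
  then show ?thesis
    using False assms(1) sgn_poly_eq_if_no_root[of a t p] by simp
qed

lemma sgn_poly_left_of:
  fixes p :: "real poly"
  assumes "t < b"
    and "\<And>r. t \<le> r \<Longrightarrow> r < b \<Longrightarrow> poly p r \<noteq> 0"
    and "\<And>r. t \<le> r \<Longrightarrow> r < b \<Longrightarrow> poly (pderiv p) r \<noteq> 0"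
  shows "sgn (poly p t) = (if poly p b = 0 then - sgn (poly (pderiv p) t) else sgn (poly p b))"
proof -
  let ?q = "pcompose p [:0, -1:]"
  have d: "poly (pderiv ?q) r = - poly (pderiv p) (- r)" for r
    by (simp add: pderiv_pcompose poly_pcompose pderiv_pCons)
  have "sgn (poly ?q (- t)) =
      (if poly ?q (- b) = 0 then sgn (poly (pderiv ?q) (- t)) else sgn (poly ?q (- b)))"
    by (rule sgn_poly_right_of) (use assms in \<open>auto simp: d poly_pcompose\<close>)
  then show ?thesis by (simp add: d poly_pcompose sgn_minus)
qed

text \<open>Here \<open>c\<close> plays a root inside a cell and \<open>a\<close> the left end of
  the cell, possibly a critical point. The mean value theorem lets the sign at the end point record
  the sign of the derivative in the cell.\<close>

lemma sgn_poly_left_of_root: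
  fixes p :: "real poly"
  assumes "a < c" "poly p c = 0"
    and "\<And>r. a < r \<Longrightarrow> r \<le> c \<Longrightarrow> poly (pderiv p) r \<noteq> 0"
  shows "sgn (poly p a) = - sgn (poly (pderiv p) c)"
proof -
  obtain x where x: "a < x" "x < c" "poly p c - poly p a = (c - a) * poly (pderiv p) x"
    using poly_MVT assms(1) by blast
  then have "poly p a = (c - a) * - poly (pderiv p) x" using assms(2) by simp
  then have "sgn (poly p a) = - sgn (poly (pderiv p) x)"
    using x by (simp add: sgn_mult sgn_minus)
  moreover have "sgn (poly (pderiv p) x) = sgn (poly (pderiv p) c)"
    using x assms by (intro sgn_poly_eq_if_no_root) auto
  ultimately show ?thesis by simp
qed

lemma sgn_poly_right_of_root:
  fixes p :: "real poly"
  assumes "c < b" "poly p c = 0"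
    and "\<And>r. c \<le> r \<Longrightarrow> r < b \<Longrightarrow> poly (pderiv p) r \<noteq> 0"
  shows "sgn (poly p b) = sgn (poly (pderiv p) c)"
proof -
  obtain x where x: "c < x" "x < b" "poly p b - poly p c = (b - c) * poly (pderiv p) x"
    using poly_MVT assms(1) by blast
  then have "sgn (poly p b) = sgn (poly (pderiv p) x)"
    using assms(2) by (simp add: sgn_mult)
  moreover have "sgn (poly (pderiv p) c) = sgn (poly (pderiv p) x)"
    using x assms by (intro sgn_poly_eq_if_no_root) auto
  ultimately show ?thesis by simp
qed

lemma poly_Rolle:
  fixes p :: "real poly"
  assumes "a < b" "poly p a = 0" "poly p b = 0"
  obtains x where "a < x" "x < b" "poly (pderiv p) x = 0"
  using poly_MVT[OF assms(1), of p] assms by auto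

section \<open>Matched cell decompositions of the line\<close>

text \<open>
  The sign behaviour of univariate polynomials on the line is compared with that of other
  polynomials on a second copy of the line: a finite set \<open>S\<close> of pairs of points cuts both lines
  into corresponding cells. A matching is such an \<open>S\<close> whose two projections are ordered alike.
\<close>

definition same_cell :: "(real \<times> real) set \<Rightarrow> real \<Rightarrow> real \<Rightarrow> bool" where
  "same_cell S t t' \<longleftrightarrow> (\<forall>a a'. (a, a') \<in> S \<longrightarrow> sgn (t - a) = sgn (t' - a'))"

definition matching :: "(real \<times> real) set \<Rightarrow> bool" where
  "matching S \<longleftrightarrow> finite S \<and> (\<forall>b b'. (b, b') \<in> S \<longrightarrow> same_cell S b b')"

definition sgn_invariant :: "(real \<times> real) set \<Rightarrow> real poly \<Rightarrow> real poly \<Rightarrow> bool" where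
  "sgn_invariant S p p' \<longleftrightarrow> (\<forall>t t'. same_cell S t t' \<longrightarrow> sgn (poly p t) = sgn (poly p' t'))"

lemma sgn_diff_eq_iff:
  fixes t a t' a' :: real
  shows "sgn (t - a) = sgn (t' - a') \<longleftrightarrow> (a < t \<longleftrightarrow> a' < t') \<and> (t < a \<longleftrightarrow> t' < a')"
  by (auto simp: sgn_if)

lemma same_cellD:
  assumes "same_cell S t t'" "(a, a') \<in> S"
  shows "a < t \<longleftrightarrow> a' < t'" "t < a \<longleftrightarrow> t' < a'" "t = a \<longleftrightarrow> t' = a'"
  using assms unfolding same_cell_def by (fastforce simp: sgn_diff_eq_iff)+

lemma same_cellI:
  assumes "\<And>a a'. (a, a') \<in> S \<Longrightarrow> (a < t \<longleftrightarrow> a' < t') \<and> (t < a \<longleftrightarrow> t' < a')"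
  shows "same_cell S t t'"
  using assms unfolding same_cell_def by (auto simp: sgn_diff_eq_iff)

lemma same_cell_mono: "same_cell S t t' \<Longrightarrow> R \<subseteq> S \<Longrightarrow> same_cell R t t'"
  unfolding same_cell_def by blast

lemma same_cell_converse: "same_cell (S\<inverse>) t' t \<longleftrightarrow> same_cell S t t'"
  unfolding same_cell_def by fastforce

lemma matching_converse: "matching (S\<inverse>) \<longleftrightarrow> matching S"
  unfolding matching_def by (fastforce simp: same_cell_converse)

lemma sgn_invariant_converse: "sgn_invariant (S\<inverse>) p' p \<longleftrightarrow> sgn_invariant S p p'"
  unfolding sgn_invariant_def by (auto simp: same_cell_converse)

lemma matchingD: "matching S \<Longrightarrow> (a, a') \<in> S \<Longrightarrow> same_cell S a a'"
  unfolding matching_def by blast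

lemma sgn_invariantD: "sgn_invariant S p p' \<Longrightarrow> same_cell S t t' \<Longrightarrow> sgn (poly p t) = sgn (poly p' t')"
  unfolding sgn_invariant_def by blast

lemma finite_sets_separated:
  fixes L R :: "real set"
  assumes "finite L" "finite R" "\<And>l r. l \<in> L \<Longrightarrow> r \<in> R \<Longrightarrow> l < r"
  shows "\<exists>t. (\<forall>l\<in>L. l < t) \<and> (\<forall>r\<in>R. t < r)"
proof (cases "L = {} \<or> R = {}")
  case True
  have "\<exists>t. \<forall>l\<in>L. l < t" using \<open>finite L\<close> by (meson Max_ge gt_ex le_less_trans)
  moreover have "\<exists>t. \<forall>r\<in>R. t < r" using \<open>finite R\<close> by (meson Min_le lt_ex less_le_trans)
  ultimately show ?thesis using True by auto
next
  case False
  then have "Max L < Min R" using assms by simp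
  then obtain t where "Max L < t" "t < Min R" using dense by blast
  then show ?thesis using False assms by auto
qed

text \<open>The partners of the cut points to the left of \<open>t\<close> lie to the left of the
  partners of those to its right, and two finite sets in this position can be separated by a
  point.\<close>

lemma same_cell_exists:
  assumes "matching S"
  obtains t' where "same_cell S t t'"
proof (cases "t \<in> Domain S")
  case True
  then show ?thesis using that assms matchingD by blast
next
  case False
  define L where "L = {a'. \<exists>a. (a, a') \<in> S \<and> a < t}"
  define R where "R = {a'. \<exists>a. (a, a') \<in> S \<and> t < a}"
  have "L \<subseteq> Range S" "R \<subseteq> Range S" by (auto simp: L_def R_def)
  moreover have "finite (Range S)" using assms by (simp add: matching_def finite_Range)
  ultimately have fin: "finite L" "finite R" using finite_subset by auto
  have "l < r" if "l \<in> L" "r \<in> R" for l r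
  proof -
    obtain a b where "(a, l) \<in> S" "a < t" "(b, r) \<in> S" "t < b"
      using \<open>l \<in> L\<close> \<open>r \<in> R\<close> by (auto simp: L_def R_def)
    then show ?thesis using same_cellD(1)[OF matchingD[OF assms, of b r], of a l] by linarith
  qed
  then obtain t' where t': "\<forall>l\<in>L. l < t'" "\<forall>r\<in>R. t' < r"
    using fin finite_sets_separated by metis
  have "same_cell S t t'"
  proof (rule same_cellI)
    fix a a' assume a: "(a, a') \<in> S"
    then have "a \<noteq> t" using False by auto
    then consider "a < t" "a' \<in> L" | "t < a" "a' \<in> R"
      using a by (fastforce simp: L_def R_def)
    then show "(a < t \<longleftrightarrow> a' < t') \<and> (t < a \<longleftrightarrow> t' < a')"
      using t' by cases (auto dest: bspec)
  qed
  then show ?thesis by (rule that)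
qed

text \<open>Off the cut points, the cell of \<open>a\<close> contains an interval, on which
  \<open>p\<close> would have the constant sign 0; a nonzero polynomial does not allow this.\<close>

lemma root_in_Domain:
  assumes S: "matching S" and inv: "sgn_invariant S p p'" and "p \<noteq> 0" "poly p a = 0"
  obtains a' where "(a, a') \<in> S" "poly p' a' = 0"
proof -
  have "a \<in> Domain S"
  proof (rule ccontr)
    assume nin: "a \<notin> Domain S"
    obtain t' where t': "same_cell S a t'" using same_cell_exists S by blast
    have "finite (Domain S)" using S by (simp add: matching_def finite_Domain)
    then obtain d where d: "d > 0" "\<forall>x\<in>Domain S. x \<noteq> a \<longrightarrow> d \<le> dist a x"
      using finite_set_avoid by blast
    have "poly p u = 0" if "u \<in> {a<..<a+d}" for u
    proof -
      have "same_cell S u t'"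
      proof (rule same_cellI)
        fix b b' assume b: "(b, b') \<in> S"
        with nin d have "d \<le> \<bar>a - b\<bar>" by (force simp: dist_real_def)
        with that same_cellD[OF t' b]
        show "(b < u \<longleftrightarrow> b' < t') \<and> (u < b \<longleftrightarrow> t' < b')" by auto
      qed
      then have "sgn (poly p u) = sgn (poly p a)"
        using t' inv by (metis sgn_invariantD)
      then show ?thesis using \<open>poly p a = 0\<close> by (simp add: sgn_0_0)
    qed
    then have "{a<..<a+d} \<subseteq> {u. poly p u = 0}" by auto
    moreover have "infinite {a<..<a+d}" using d(1) by (simp add: infinite_Ioo)
    ultimately show False using poly_roots_finite[OF \<open>p \<noteq> 0\<close>] finite_subset by blast
  qed
  then obtain a' where a': "(a, a') \<in> S" by auto
  then have "sgn (poly p a) = sgn (poly p' a')"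
    using S inv matchingD sgn_invariantD by blast
  then show ?thesis using that a' \<open>poly p a = 0\<close> by (metis sgn_0_0 sgn_0)
qed

lemma root_in_Range:
  assumes "matching S" "sgn_invariant S p p'" "p' \<noteq> 0" "poly p' a' = 0"
  obtains a where "(a, a') \<in> S" "poly p a = 0"
  using root_in_Domain[of "S\<inverse>" p' p a'] assms
  by (auto simp: matching_converse sgn_invariant_converse)

lemma sgn_invariant_restrict:
  assumes S: "matching S"
    and inv: "\<And>p p'. (p, p') \<in> G \<Longrightarrow> sgn_invariant S p p'"
    and nz: "\<And>p p'. (p, p') \<in> G \<Longrightarrow> p \<noteq> 0 \<and> p' \<noteq> 0"
  defines "R \<equiv> {(a, a')\<in>S. \<exists>(p, p')\<in>G. poly p a = 0}"
  shows "matching R" "\<And>p p'. (p, p') \<in> G \<Longrightarrow> sgn_invariant R p p'"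
proof -
  have RS: "R \<subseteq> S" by (auto simp: R_def)
  then show "matching R"
    using S unfolding matching_def by (meson finite_subset same_cell_mono subsetD)
  fix p p' assume G: "(p, p') \<in> G"
  show "sgn_invariant R p p'" unfolding sgn_invariant_def
  proof (intro allI impI)
    fix t t' assume tt': "same_cell R t t'"
    obtain u where u: "same_cell S t u" using same_cell_exists S by blast
    have uR: "same_cell R t u" using same_cell_mono u RS by blast
    \<comment> \<open>Such a root would be a cut point of \<open>R\<close> weakly between
      \<open>u\<close> and \<open>t'\<close>, although both lie in the cell of \<open>R\<close> that
      corresponds to \<open>t\<close>.\<close>
    have no_root: "u = t'" if r: "poly p' r = 0" "min u t' \<le> r" "r \<le> max u t'" for r
    proof -
      obtain a where a: "(a, r) \<in> S" "poly p a = 0"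
        using root_in_Range[OF S inv[OF G]] nz[OF G] r(1) by blast
      then have "(a, r) \<in> R" using G by (auto simp: R_def)
      then show ?thesis using same_cellD[OF tt'] same_cellD[OF uR] r(2,3)
        by (metis linorder_neqE_linordered_idom max_def min_def order.strict_iff_not)
    qed
    have "sgn (poly p' u) = sgn (poly p' t')"
    proof (cases "u = t'")
      case False
      then have "poly p' r \<noteq> 0" if "min u t' \<le> r" "r \<le> max u t'" for r
        using no_root that by blast
      then have "sgn (poly p' (min u t')) = sgn (poly p' (max u t'))"
        by (intro sgn_poly_eq_if_no_root) auto
      then show ?thesis by (auto simp: min_def max_def split: if_splits)
    qed auto
    then show "sgn (poly p t) = sgn (poly p' t')"
      using sgn_invariantD[OF inv[OF G] u] by simp
  qed
qed

text \<open>If \<open>h\<close> had no root in the cell of \<open>c\<close>, the left end of the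
  cell would give \<open>h\<close> the sign opposite to its derivative and the right end the same
  sign. In both cases the sign at the end point is read off from \<open>f\<close>, which does vanish
  inside. On an unbounded side the behaviour at infinity replaces the end point.\<close>

lemma matched_root_exists:
  assumes S: "matching S" and inv: "sgn_invariant S (pderiv f) (pderiv h)"
    and on_S: "\<And>a a'. (a, a') \<in> S \<Longrightarrow> sgn (poly f a) = sgn (poly h a')"
    and deg: "degree f > 0" "degree h > 0"
    and c: "poly f c = 0"
  obtains c' where "same_cell S c c'" "poly h c' = 0"
proof (cases "c \<in> Domain S")
  case True
  then obtain c' where "(c, c') \<in> S" by auto
  with c on_S show ?thesis
    using that S matchingD by (metis sgn_0_0 sgn_0)
next
  case False
  obtain t where t: "same_cell S c t" using same_cell_exists S by blast
  have nz: "pderiv f \<noteq> 0" "pderiv h \<noteq> 0" using deg by (auto simp: pderiv_eq_0_iff)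
  have fin: "finite (Domain S)" using S by (simp add: matching_def finite_Domain)
  have deriv_f: "r \<in> Domain S" if "poly (pderiv f) r = 0" for r
    using root_in_Domain[OF S inv nz(1) that] by blast
  have deriv_h: "\<not> same_cell S c r" if h0: "poly (pderiv h) r = 0" for r
  proof
    assume r: "same_cell S c r"
    obtain b where "(b, r) \<in> S" using root_in_Range[OF S inv nz(2) h0] by blast
    then show False using same_cellD(3)[OF r] False by blast
  qed
  have sgn_deriv: "sgn (poly (pderiv f) c) = sgn (poly (pderiv h) t)"
    using inv t sgn_invariantD by blast
  \<comment> \<open>Roots of the derivative are cut points and \<open>c\<close> is none, so
    \<open>c\<close> is a simple root.\<close>
  have deriv_c: "poly (pderiv f) c \<noteq> 0" using False deriv_f by blast
  have "\<exists>c'. same_cell S c c' \<and> poly h c' = 0"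
  proof (rule ccontr)
    assume "\<nexists>c'. same_cell S c c' \<and> poly h c' = 0"
    then have no_root: "poly h r \<noteq> 0" if "same_cell S c r" for r using that by blast
    have left: "sgn (poly h t) = - sgn (poly (pderiv h) t)"
    proof (cases "{a\<in>Domain S. a < c} = {}")
      case True
      then have cell: "same_cell S c r" if "r \<le> t" for r
        using that False same_cellD[OF t] by (intro same_cellI) fastforce
      show ?thesis
        by (rule sgn_poly_minus_infinity[OF deg(2)]) (use no_root deriv_h cell in blast)+
    next
      case ne: False
      define a where "a = Max {a\<in>Domain S. a < c}"
      have "a \<in> {a\<in>Domain S. a < c}" unfolding a_def using fin ne by (intro Max_in) auto
      then obtain a' where a': "(a, a') \<in> S" "a < c" by auto
      have max: "b \<le> a" if "b \<in> Domain S" "b < c" for b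
        unfolding a_def using fin that by (intro Max_ge) auto
      have "sgn (poly f a) = - sgn (poly (pderiv f) c)"
        using a'(2) c False deriv_f max by (intro sgn_poly_left_of_root) force+
      then have sa: "sgn (poly h a') = - sgn (poly (pderiv f) c)" using on_S a' by simp
      have cell: "same_cell S c r" if r: "a' < r" "r \<le> t" for r
      proof (rule same_cellI)
        fix b b' assume b: "(b, b') \<in> S"
        have "b \<noteq> c" using b False by auto
        moreover have "b' \<le> a'" if "b < c"
          using max[of b] b that same_cellD(1)[OF matchingD[OF S b] a'(1)] by fastforce
        ultimately show "(b < c \<longleftrightarrow> b' < r) \<and> (c < b \<longleftrightarrow> r < b')"
          using same_cellD[OF t b] r by fastforce
      qed
      have "a' < t" using same_cellD(1)[OF t a'(1)] a'(2) by blast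
      then have "sgn (poly h t) = (if poly h a' = 0 then sgn (poly (pderiv h) t) else sgn (poly h a'))"
        by (rule sgn_poly_right_of) (use no_root deriv_h cell in blast)+
      then show ?thesis using sa sgn_deriv deriv_c by (auto simp: sgn_0_0)
    qed
    have right: "sgn (poly h t) = sgn (poly (pderiv h) t)"
    proof (cases "{b\<in>Domain S. c < b} = {}")
      case True
      then have cell: "same_cell S c r" if "t \<le> r" for r
        using that False same_cellD[OF t] by (intro same_cellI) fastforce
      show ?thesis
        by (rule sgn_poly_plus_infinity[OF deg(2)]) (use no_root deriv_h cell in blast)+
    next
      case ne: False
      define a where "a = Min {b\<in>Domain S. c < b}"
      have "a \<in> {b\<in>Domain S. c < b}" unfolding a_def using fin ne by (intro Min_in) auto
      then obtain a' where a': "(a, a') \<in> S" "c < a" by auto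
      have min: "a \<le> b" if "b \<in> Domain S" "c < b" for b
        unfolding a_def using fin that by (intro Min_le) auto
      have "sgn (poly f a) = sgn (poly (pderiv f) c)"
        using a'(2) c False deriv_f min by (intro sgn_poly_right_of_root) force+
      then have sa: "sgn (poly h a') = sgn (poly (pderiv f) c)" using on_S a' by simp
      have cell: "same_cell S c r" if r: "t \<le> r" "r < a'" for r
      proof (rule same_cellI)
        fix b b' assume b: "(b, b') \<in> S"
        have "b \<noteq> c" using b False by auto
        moreover have "a' \<le> b'" if "c < b"
          using min[of b] b that same_cellD(2)[OF matchingD[OF S b] a'(1)] by fastforce
        ultimately show "(b < c \<longleftrightarrow> b' < r) \<and> (c < b \<longleftrightarrow> r < b')"
          using same_cellD[OF t b] r by fastforce
      qed
      have "t < a'" using same_cellD(2)[OF t a'(1)] a'(2) by blast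
      then have "sgn (poly h t) = (if poly h a' = 0 then - sgn (poly (pderiv h) t) else sgn (poly h a'))"
        by (rule sgn_poly_left_of) (use no_root deriv_h cell in blast)+
      then show ?thesis using sa sgn_deriv deriv_c by (auto simp: sgn_0_0)
    qed
    have "sgn (poly (pderiv h) t) \<noteq> 0" using sgn_deriv deriv_c by (metis sgn_0_0)
    then show False using left right by simp
  qed
  then show ?thesis using that by blast
qed

text \<open>By Rolle's theorem two roots of \<open>f\<close> are separated by a cut point of
  \<open>S\<close>, and likewise for \<open>h\<close>; hence the new pairs are ordered consistently.
  On a cell of \<open>T\<close> the sign of \<open>f\<close> follows from its sign at the left end
  and the sign of the derivative, data that \<open>f\<close> and \<open>h\<close> share.\<close>

lemma matching_extend_by_roots:
  assumes S: "matching S" and inv: "sgn_invariant S (pderiv f) (pderiv h)"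
    and on_S: "\<And>a a'. (a, a') \<in> S \<Longrightarrow> sgn (poly f a) = sgn (poly h a')"
    and deg: "degree f > 0" "degree h > 0"
  defines "T \<equiv> S \<union> {(c, c'). same_cell S c c' \<and> poly f c = 0 \<and> poly h c' = 0}"
  shows "matching T" "sgn_invariant T f h"
proof -
  have nz: "pderiv f \<noteq> 0" "pderiv h \<noteq> 0" "f \<noteq> 0" "h \<noteq> 0" using deg by (auto simp: pderiv_eq_0_iff)
  have "T \<subseteq> S \<union> {c. poly f c = 0} \<times> {c. poly h c = 0}" by (auto simp: T_def)
  moreover have "finite (S \<union> {c. poly f c = 0} \<times> {c. poly h c = 0})"
    using S nz poly_roots_finite by (auto simp: matching_def)
  ultimately have finT: "finite T" by (rule finite_subset)
  have on_T: "sgn (poly f a) = sgn (poly h a')" if "(a, a') \<in> T" for a a'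
    using that on_S by (auto simp: T_def)
  have cell_S: "same_cell S b b'" if "(b, b') \<in> T" for b b'
    using that S matchingD by (auto simp: T_def)
  have "(a < b \<longleftrightarrow> a' < b') \<and> (b < a \<longleftrightarrow> b' < a')" if "(a, a') \<in> T" "(b, b') \<in> T" for a a' b b'
  proof (cases "(a, a') \<in> S \<or> (b, b') \<in> S")
    case True
    then show ?thesis using cell_S that same_cellD by meson
  next
    case False
    then have a: "same_cell S a a'" "poly f a = 0" "poly h a' = 0"
      and b: "same_cell S b b'" "poly f b = 0" "poly h b' = 0"
      using that by (auto simp: T_def)
    have imp: "x' < y'" if xy: "x < y" "poly f x = 0" "poly f y = 0" "same_cell S x x'" "same_cell S y y'" for x y x' y'
    proof -
      obtain z where z: "x < z" "z < y" "poly (pderiv f) z = 0"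
        using poly_Rolle xy by blast
      then obtain z' where "(z, z') \<in> S" using root_in_Domain[OF S inv nz(1)] by blast
      then show ?thesis using same_cellD[OF xy(4)] same_cellD[OF xy(5)] z by fastforce
    qed
    have imp': "x < y" if xy: "x' < y'" "poly h x' = 0" "poly h y' = 0" "same_cell S x x'" "same_cell S y y'" for x y x' y'
    proof -
      obtain z' where z: "x' < z'" "z' < y'" "poly (pderiv h) z' = 0"
        using poly_Rolle xy by blast
      then obtain z where "(z, z') \<in> S" using root_in_Range[OF S inv nz(2)] by blast
      then show ?thesis using same_cellD[OF xy(4)] same_cellD[OF xy(5)] z by fastforce
    qed
    show ?thesis using imp imp' a b by meson
  qed
  then show "matching T" unfolding matching_def using finT by (blast intro: same_cellI)
  have root_f: "\<exists>c'. (c, c') \<in> T" if "poly f c = 0" for c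
    using matched_root_exists[OF S inv on_S deg that] that by (auto simp: T_def)
  have root_h: "\<exists>c. (c, c') \<in> T" if h0: "poly h c' = 0" for c'
  proof -
    obtain c where "same_cell (S\<inverse>) c' c" "poly f c = 0"
    proof (rule matched_root_exists[of "S\<inverse>" h f c'])
      show "sgn (poly h a) = sgn (poly f a')" if "(a, a') \<in> S\<inverse>" for a a'
        using that on_S by auto
    qed (use S inv deg h0 in \<open>auto simp: matching_converse sgn_invariant_converse\<close>)
    then show ?thesis using h0 by (auto simp: T_def same_cell_converse)
  qed
  have deriv_f: "\<exists>c'. (c, c') \<in> T" if "poly (pderiv f) c = 0" for c
    using root_in_Domain[OF S inv nz(1) that] by (auto simp: T_def)
  have deriv_h: "\<exists>c. (c, c') \<in> T" if "poly (pderiv h) c' = 0" for c'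
    using root_in_Range[OF S inv nz(2) that] by (auto simp: T_def)
  show "sgn_invariant T f h" unfolding sgn_invariant_def
  proof (intro allI impI)
    fix t t' assume cell: "same_cell T t t'"
    then have "same_cell S t t'" using same_cell_mono by (auto simp: T_def)
    then have sgn_deriv: "sgn (poly (pderiv f) t) = sgn (poly (pderiv h) t')"
      using inv sgn_invariantD by blast
    show "sgn (poly f t) = sgn (poly h t')"
    proof (cases "t \<in> Domain T")
      case True
      then obtain a' where "(t, a') \<in> T" by auto
      then show ?thesis using on_T same_cellD(3)[OF cell] by blast
    next
      case tD: False
      show ?thesis
      proof (cases "{a\<in>Domain T. a < t} = {}")
        case True
        have D: False if "(r, r') \<in> T" "r \<le> t \<or> r' \<le> t'" for r r'
          using True that same_cellD[OF cell that(1)] tD by fastforce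
        have "sgn (poly f t) = - sgn (poly (pderiv f) t)"
          by (rule sgn_poly_minus_infinity[OF deg(1)]) (use D root_f deriv_f in blast)+
        moreover have "sgn (poly h t') = - sgn (poly (pderiv h) t')"
          by (rule sgn_poly_minus_infinity[OF deg(2)]) (use D root_h deriv_h in blast)+
        ultimately show ?thesis using sgn_deriv by simp
      next
        case ne: False
        define a where "a = Max {a\<in>Domain T. a < t}"
        have fin: "finite (Domain T)" using finT by (simp add: finite_Domain)
        have "a \<in> {a\<in>Domain T. a < t}" unfolding a_def using fin ne by (intro Max_in) auto
        then obtain a' where a': "(a, a') \<in> T" "a < t" by auto
        have max: "b \<le> a" if "b \<in> Domain T" "b < t" for b
          unfolding a_def using fin that by (intro Max_ge) auto
        have D: False if "(r, r') \<in> T" "a < r \<and> r \<le> t \<or> a' < r' \<and> r' \<le> t'" for r r'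
          using max[of r] that same_cellD[OF cell that(1)] tD
            same_cellD[OF matchingD[OF \<open>matching T\<close> that(1)] a'(1)] by fastforce
        have "a' < t'" using same_cellD(1)[OF cell a'(1)] a'(2) by blast
        then have "sgn (poly h t') = (if poly h a' = 0 then sgn (poly (pderiv h) t') else sgn (poly h a'))"
          by (rule sgn_poly_right_of) (use D root_h deriv_h in blast)+
        moreover have "sgn (poly f t) = (if poly f a = 0 then sgn (poly (pderiv f) t) else sgn (poly f a))"
          using a'(2) by (rule sgn_poly_right_of) (use D root_f deriv_f in blast)+
        ultimately show ?thesis using sgn_deriv on_T[OF a'(1)] by (metis sgn_0_0 sgn_0)
      qed
    qed
  qed
qed

section \<open>Polynomials with parameters\<close>

lemma poly_fun_uminus: "p \<in> poly_fun \<Longrightarrow> (\<lambda>x. - p x) \<in> poly_fun"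
  using poly_fun.mult[OF poly_fun.const[of "-1"]] by fastforce

lemma poly_fun_diff: "p \<in> poly_fun \<Longrightarrow> q \<in> poly_fun \<Longrightarrow> (\<lambda>x. p x - q x) \<in> poly_fun"
  using poly_fun.add[OF _ poly_fun_uminus, of p q] by simp

lemma poly_fun_power: "p \<in> poly_fun \<Longrightarrow> (\<lambda>x. p x ^ n) \<in> poly_fun"
  by (induction n) (auto intro: poly_fun.const poly_fun.mult)

lemma poly_fun_sum: "(\<And>i. i \<in> I \<Longrightarrow> p i \<in> poly_fun) \<Longrightarrow> (\<lambda>x. \<Sum>i\<in>I. p i x) \<in> poly_fun"
  by (induction I rule: infinite_finite_induct) (auto intro: poly_fun.const poly_fun.add)

lemma poly_fun_prod: "(\<And>i. i \<in> I \<Longrightarrow> p i \<in> poly_fun) \<Longrightarrow> (\<lambda>x. \<Prod>i\<in>I. p i x) \<in> poly_fun"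
  by (induction I rule: infinite_finite_induct) (auto intro: poly_fun.const poly_fun.mult)

lemmas poly_fun_intros = poly_fun.intros poly_fun_uminus poly_fun_diff poly_fun_power
  poly_fun_sum poly_fun_prod

text \<open>The number \<open>n\<close> is a strict bound for the degree in the line variable, so
  that bound 0 means the zero polynomial. A bound is used because the degree itself varies with the
  parameter.\<close>

definition param_poly :: "nat \<Rightarrow> ('a::euclidean_space \<Rightarrow> real poly) set" where
  "param_poly n = {P. (\<forall>i. (\<lambda>x. coeff (P x) i) \<in> poly_fun) \<and> (\<forall>x. \<forall>i\<ge>n. coeff (P x) i = 0)}"

lemma param_poly_mono: "m \<le> n \<Longrightarrow> param_poly m \<subseteq> param_poly n"
  by (auto simp: param_poly_def)

lemma pderiv_param_poly: "P \<in> param_poly n \<Longrightarrow> (\<lambda>x. pderiv (P x)) \<in> param_poly (n - 1)"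
  by (auto simp: param_poly_def coeff_pderiv intro!: poly_fun_intros)

lemma truncate_param_poly:
  assumes "P \<in> param_poly (Suc n)"
  shows "(\<lambda>x. P x - monom (coeff (P x) n) n) \<in> param_poly n"
proof -
  have "(\<lambda>x. coeff (P x - monom (coeff (P x) n) n) i) \<in> poly_fun" for i
    using assms by (cases "i = n") (auto simp: param_poly_def intro: poly_fun_intros)
  moreover have "coeff (P x - monom (coeff (P x) n) n) i = 0" if "i \<ge> n" for x i
    using assms that by (cases "i = n") (auto simp: param_poly_def)
  ultimately show ?thesis unfolding param_poly_def by blast
qed

text \<open>Pseudo-division, with squares of the leading coefficient as factors so that signs are preserved.\<close>

lemma remainder_param_poly:
  assumes g: "g \<in> param_poly (Suc k)" and "f \<in> param_poly n"
  shows "\<exists>r\<in>param_poly k. \<forall>x t. coeff (g x) k \<noteq> 0 \<longrightarrow> poly (g x) t = 0 \<longrightarrow>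
    sgn (poly (f x) t) = sgn (poly (r x) t)"
  using assms(2)
proof (induction n arbitrary: f)
  case 0
  then show ?case using param_poly_mono[of 0 k] by auto
next
  case (Suc n)
  show ?case
  proof (cases "Suc n \<le> k")
    case True
    then show ?thesis using Suc.prems param_poly_mono by blast
  next
    case False
    define b where "b x = coeff (g x) k" for x
    \<comment> \<open>Both summands have the coefficient \<open>b x ^ 2 * coeff (f x) n\<close> at
      exponent \<open>n\<close>, so it cancels. At a root of \<open>g x\<close> only the first
      summand survives, and its factor is a square.\<close>
    define f1 where "f1 x = smult (b x ^ 2) (f x) -
      smult (coeff (f x) n * b x) (monom 1 (n - k) * g x)" for x
    have cf: "coeff (f1 x) i = b x ^ 2 * coeff (f x) i -
      coeff (f x) n * b x * (if i < n - k then 0 else coeff (g x) (i - (n - k)))" for x i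
      by (simp add: f1_def coeff_monom_mult)
    have "(\<lambda>x. coeff (f1 x) i) \<in> poly_fun" for i
      unfolding cf b_def using g Suc.prems
      by (cases "i < n - k") (auto simp: param_poly_def intro!: poly_fun_intros)
    moreover have "coeff (f1 x) i = 0" if "i \<ge> n" for x i
    proof (cases "i = n")
      case True
      have "n - (n - k) = k" using False by simp
      then show ?thesis unfolding cf using False True by (simp add: b_def power2_eq_square)
    next
      case ne: False
      then have "i \<ge> Suc n" "i - (n - k) \<ge> Suc k" using that False by auto
      then show ?thesis unfolding cf using g Suc.prems by (simp add: param_poly_def)
    qed
    ultimately have "f1 \<in> param_poly n" unfolding param_poly_def by blast
    then obtain r where r: "r \<in> param_poly k" "\<forall>x t. coeff (g x) k \<noteq> 0 \<longrightarrow> poly (g x) t = 0 \<longrightarrow>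
        sgn (poly (f1 x) t) = sgn (poly (r x) t)" using Suc.IH by blast
    have "sgn (poly (f1 x) t) = sgn (poly (f x) t)" if "coeff (g x) k \<noteq> 0" "poly (g x) t = 0" for x t
    proof -
      have "poly (f1 x) t = b x ^ 2 * poly (f x) t" using that by (simp add: f1_def)
      moreover have "b x ^ 2 > 0" using that by (simp add: b_def)
      ultimately show ?thesis by (simp only: sgn_mult sgn_pos mult_1_left)
    qed
    then show ?thesis using r by metis
  qed
qed

text \<open>
  Hoermander's elimination: replace a member \<open>f\<close> of maximal degree by its derivative and its
  remainders modulo the other members and modulo the derivative.
\<close>

definition sgn_uniform :: "('a::euclidean_space \<Rightarrow> real poly) set \<Rightarrow> ('a \<Rightarrow> real) set \<Rightarrow> bool" where
  "sgn_uniform \<P> Q \<longleftrightarrow> finite Q \<and> Q \<subseteq> poly_fun \<and>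
    (\<forall>x y. (\<forall>q\<in>Q. sgn (q x) = sgn (q y)) \<longrightarrow>
      (\<exists>S. matching S \<and> (\<forall>P\<in>\<P>. sgn_invariant S (P x) (P y))))"

lemma matching_empty: "matching {}"
  by (simp add: matching_def)

text \<open>After the restriction every cut point is a root of some \<open>g\<close> in
  \<open>\<G>\<close>, where \<open>f\<close> has the sign of the remainder \<open>R g\<close>, and
  that sign is invariant. So \<open>f\<close> agrees in sign at matched points, and since its
  derivative belongs to \<open>\<G>\<close>, its roots can be added.\<close>

lemma sgn_invariant_elimination_step:
  assumes S: "matching S"
    and inv: "\<And>g. g \<in> \<G> \<Longrightarrow> sgn_invariant S (g x) (g y)"
    and f': "(\<lambda>x. pderiv (f x)) \<in> \<G>"
    and nz: "\<And>g. g \<in> \<G> \<Longrightarrow> g x \<noteq> 0 \<and> g y \<noteq> 0"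
    and deg: "degree (f x) > 0" "degree (f y) > 0"
    and R: "\<And>g. g \<in> \<G> \<Longrightarrow> sgn_invariant S (R g x) (R g y)"
    and rem: "\<And>g z t. g \<in> \<G> \<Longrightarrow> z \<in> {x, y} \<Longrightarrow> poly (g z) t = 0 \<Longrightarrow>
      sgn (poly (f z) t) = sgn (poly (R g z) t)"
  shows "\<exists>T. matching T \<and> (\<forall>g\<in>insert f \<G>. sgn_invariant T (g x) (g y))"
proof -
  let ?G = "(\<lambda>g. (g x, g y)) ` \<G>"
  define S' where "S' = {(a, a')\<in>S. \<exists>(p, p')\<in>?G. poly p a = 0}"
  have G: "sgn_invariant S p p'" "p \<noteq> 0 \<and> p' \<noteq> 0" if "(p, p') \<in> ?G" for p p'
    using that inv nz by auto
  note restrict = sgn_invariant_restrict[OF S, of ?G, folded S'_def, OF G]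
  have S': "matching S'" by (rule restrict(1)) auto
  have inv': "sgn_invariant S' (g x) (g y)" if "g \<in> \<G>" for g
    by (rule restrict(2)) (use that in auto)
  have on_S': "sgn (poly (f x) a) = sgn (poly (f y) a')" if aa': "(a, a') \<in> S'" for a a'
  proof -
    obtain g where g: "g \<in> \<G>" "poly (g x) a = 0" "(a, a') \<in> S" using aa' by (auto simp: S'_def)
    have cell: "same_cell S a a'" using S g(3) matchingD by blast
    then have "poly (g y) a' = 0"
      using sgn_invariantD[OF inv[OF g(1)]] g(2) by (metis sgn_0_0 sgn_0)
    then show ?thesis using rem[OF g(1)] g(2) sgn_invariantD[OF R[OF g(1)] cell] by simp
  qed
  define T where "T = S' \<union> {(c, c'). same_cell S' c c' \<and> poly (f x) c = 0 \<and> poly (f y) c' = 0}"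
  have "matching T" "sgn_invariant T (f x) (f y)"
    unfolding T_def using matching_extend_by_roots[OF S' inv'[OF f'] on_S' deg] by auto
  moreover have "sgn_invariant T (g x) (g y)" if "g \<in> \<G>" for g
    using inv'[OF that] same_cell_mono[of T _ _ S'] unfolding sgn_invariant_def T_def by blast
  ultimately show ?thesis by blast
qed

text \<open>The signs of finitely many polynomials in the parameter fix the sign diagram of the
  whole family. The recursion is well-founded for the multiset order on degree bounds: one member is
  exchanged for finitely many members of smaller bound.\<close>

lemma sgn_uniform_exists:
  assumes "\<And>n P. (n, P) \<in># M \<Longrightarrow> P \<in> param_poly n"
  shows "\<exists>Q. sgn_uniform (snd ` set_mset M) Q"
proof -
  have "wf (mult (inv_image less_than (fst :: nat \<times> ('a \<Rightarrow> real poly) \<Rightarrow> nat)))" by (intro wf_mult) simp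
  then show ?thesis using assms
  proof (induction M rule: wf_induct_rule)
    case (less M)
    have smaller: "\<exists>Q. sgn_uniform (snd ` set_mset (M0 + K)) Q"
      if "M = add_mset (n, P) M0" "\<And>m R. (m, R) \<in># K \<Longrightarrow> m < n \<and> R \<in> param_poly m" for n P M0 K
    proof (rule less.IH)
      show "(M0 + K, M) \<in> mult (inv_image less_than fst)"
        using one_step_implies_mult[of "{#(n, P)#}" K "inv_image less_than fst" M0] that by fastforce
      show "\<And>m R. (m, R) \<in># M0 + K \<Longrightarrow> R \<in> param_poly m"
        using that less.prems by auto
    qed
    \<comment> \<open>Bound 0 gives a zero polynomial, which can be removed; if all bounds are 1,
      the constant coefficients themselves serve as \<open>Q\<close>. Otherwise a member of largest
      bound is eliminated, and all bounds are positive, so that \<open>m - 1\<close> is the index of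
      the formal leading coefficient.\<close>
    consider (zero) P where "(0, P) \<in># M" | (const) "\<And>n P. (n, P) \<in># M \<Longrightarrow> n = 1"
      | (high) n f where "(Suc n, f) \<in># M" "n > 0"
          "\<And>m P. (m, P) \<in># M \<Longrightarrow> m > 0 \<and> m \<le> Suc n"
    proof (cases "(\<exists>P. (0, P) \<in># M) \<or> (\<forall>n P. (n, P) \<in># M \<longrightarrow> n = 1)")
      case True
      then show ?thesis using zero const by blast
    next
      case False
      define N where "N = Max (fst ` set_mset M)"
      have "M \<noteq> {#}" using False by auto
      then have "N \<in> fst ` set_mset M" unfolding N_def by (intro Max_in) auto
      then obtain f where f: "(N, f) \<in># M" by auto
      have le: "m \<le> N" if "(m, P) \<in># M" for m P
        unfolding N_def using that by (intro Max_ge) force+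
      obtain m P where "(m, P) \<in># M" "m \<noteq> 1" using False by auto
      then have "N \<ge> 2" using le[of m P] False by (cases m) auto
      show ?thesis
      proof (rule high)
        show "(Suc (N - 1), f) \<in># M" "N - 1 > 0" using f \<open>N \<ge> 2\<close> by auto
        show "m > 0 \<and> m \<le> Suc (N - 1)" if "(m, P) \<in># M" for m P
          using that le[OF that] False \<open>N \<ge> 2\<close> by (cases m) auto
      qed
    qed
    then show ?case
    proof cases
      case zero
      then obtain M0 where M: "M = add_mset (0, P) M0" by (metis insert_DiffM)
      then obtain Q where Q: "sgn_uniform (snd ` set_mset M0) Q" using smaller[of 0 P M0 "{#}"] by auto
      have "P x = 0" for x using less.prems[of 0 P] M by (auto simp: param_poly_def intro: poly_eqI)
      then have "sgn_uniform (snd ` set_mset M) Q"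
        using Q M by (auto simp: sgn_uniform_def sgn_invariant_def)
      then show ?thesis by blast
    next
      case const
      let ?Q = "(\<lambda>P x. coeff (P x) 0) ` snd ` set_mset M"
      have "sgn_invariant {} (P x) (P y)"
        if q: "\<forall>q\<in>?Q. sgn (q x) = sgn (q y)" "P \<in> snd ` set_mset M" for x y P
      proof -
        obtain n where "(n, P) \<in># M" using q(2) by auto
        then have P: "P \<in> param_poly 1" using const[of n P] less.prems[of n P] by auto
        have ev: "poly (P z) t = coeff (P z) 0" for z t
        proof -
          have "degree (P z) \<le> 0"
            using P by (intro degree_le) (auto simp: param_poly_def)
          then obtain c where "P z = [:c:]" by (metis degree_eq_zeroE le_zero_eq)
          then show ?thesis by simp
        qed
        show ?thesis using q by (auto simp: sgn_invariant_def ev)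
      qed
      moreover have "?Q \<subseteq> poly_fun" using less.prems by (auto simp: param_poly_def)
      ultimately have "sgn_uniform (snd ` set_mset M) ?Q"
        unfolding sgn_uniform_def using matching_empty by blast
      then show ?thesis by blast
    next
      case high
      then obtain M0 where M: "M = add_mset (Suc n, f) M0" by (metis insert_DiffM)
      define f' where "f' = (\<lambda>x. pderiv (f x))"
      define G where "G = add_mset (n, f') M0"
      have f: "f \<in> param_poly (Suc n)" using less.prems high by auto
      have f': "f' \<in> param_poly n" using pderiv_param_poly[OF f] by (simp add: f'_def)
      have G: "g \<in> param_poly m \<and> m > 0 \<and> m \<le> Suc n" if "(m, g) \<in># G" for m g
        using that less.prems[of m g] high(2) high(3)[of m g] f' by (auto simp: G_def M)
      have "\<exists>r. r \<in> param_poly (fst a - 1) \<and> (\<forall>x t. coeff (snd a x) (fst a - 1) \<noteq> 0 \<longrightarrow>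
          poly (snd a x) t = 0 \<longrightarrow> sgn (poly (f x) t) = sgn (poly (r x) t))" if "a \<in># G" for a
        using remainder_param_poly[of "snd a" "fst a - 1" f "Suc n"] f G[of "fst a" "snd a"] that by auto
      then obtain R where R: "\<And>a. a \<in># G \<Longrightarrow> R a \<in> param_poly (fst a - 1)"
        "\<And>a x t. a \<in># G \<Longrightarrow> coeff (snd a x) (fst a - 1) \<noteq> 0 \<Longrightarrow>
          poly (snd a x) t = 0 \<Longrightarrow> sgn (poly (f x) t) = sgn (poly (R a x) t)"
        by metis
      \<comment> \<open>All these bounds are at most \<open>n\<close>: the divisors in
        \<open>G\<close> have bound at most \<open>Suc n\<close>, and division lowers the bound of
        the divisor by one.\<close>
      define K where "K = add_mset (n, f') (image_mset (\<lambda>a. (fst a - 1, R a)) G)"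
      have K: "m < Suc n \<and> r \<in> param_poly m" if "(m, r) \<in># K" for m r
        using that f' R(1) G by (fastforce simp: K_def)
      obtain Q1 where Q1: "sgn_uniform (snd ` set_mset (M0 + K)) Q1"
        using smaller[OF M K] by blast
      define lead where "lead a x = coeff (snd a x) (fst a - 1)" for a :: "nat \<times> ('a \<Rightarrow> real poly)" and x
      define trunc where "trunc a = (\<lambda>x. snd a x - monom (lead a x) (fst a - 1))" for a
      \<comment> \<open>For parameters at which the formal leading coefficient of \<open>a\<close>
        vanishes, \<open>a\<close> equals its truncation, whose bound is smaller. Each
        \<open>a\<close> gets its own recursive call.\<close>
      have "\<exists>Q. sgn_uniform (snd ` set_mset ((M - {#a#}) + {#(fst a - 1, trunc a)#})) Q" if a: "a \<in># M" for a
      proof (rule smaller[of "fst a" "snd a"])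
        show "M = add_mset (fst a, snd a) (M - {#a#})" using a by simp
        have "fst a > 0" "snd a \<in> param_poly (fst a)" using a high(3) less.prems by (metis prod.collapse)+
        then show "m < fst a \<and> r \<in> param_poly m" if "(m, r) \<in># {#(fst a - 1, trunc a)#}" for m r
          using that truncate_param_poly[of "snd a" "fst a - 1"] by (auto simp: trunc_def lead_def)
      qed
      then obtain Q2 where Q2: "\<And>a. a \<in># M \<Longrightarrow>
          sgn_uniform (snd ` set_mset ((M - {#a#}) + {#(fst a - 1, trunc a)#})) (Q2 a)" by metis
      define Q where "Q = Q1 \<union> (\<Union>a\<in>set_mset M. insert (lead a) (Q2 a))"
      have "\<exists>S. matching S \<and> (\<forall>P\<in>snd ` set_mset M. sgn_invariant S (P x) (P y))"
        if agree: "\<forall>q\<in>Q. sgn (q x) = sgn (q y)" for x y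
      proof (cases "\<exists>a\<in>#M. lead a x = 0")
        case True
        then obtain a where a: "a \<in># M" "lead a x = 0" by auto
        then have "lead a \<in> Q" unfolding Q_def by blast
        then have "sgn (lead a x) = sgn (lead a y)" using agree by blast
        then have "lead a y = 0" using a by (simp add: sgn_0_0)
        then have tr: "trunc a x = snd a x" "trunc a y = snd a y" using a by (auto simp: trunc_def)
        have "\<forall>q\<in>Q2 a. sgn (q x) = sgn (q y)" using agree a(1) unfolding Q_def by blast
        then obtain S where "matching S"
            "\<forall>P\<in>snd ` set_mset ((M - {#a#}) + {#(fst a - 1, trunc a)#}). sgn_invariant S (P x) (P y)"
          using Q2[OF a(1)] unfolding sgn_uniform_def by blast
        moreover have "P = snd a \<or> P \<in> snd ` set_mset (M - {#a#})" if "P \<in> snd ` set_mset M" for P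
        proof -
          have "snd ` set_mset M = insert (snd a) (snd ` set_mset (M - {#a#}))"
            by (subst insert_DiffM[OF a(1), symmetric]) simp
          then show ?thesis using that by blast
        qed
        ultimately show ?thesis using tr by (intro exI[of _ S] conjI ballI) fastforce+
      next
        case False
        have lead: "lead a x \<noteq> 0 \<and> lead a y \<noteq> 0" if "a \<in># M" for a
        proof -
          have "lead a \<in> Q" using that unfolding Q_def by blast
          then have "sgn (lead a x) = sgn (lead a y)" using agree by blast
          then show ?thesis using False that by (metis sgn_0_0)
        qed
        have "\<forall>q\<in>Q1. sgn (q x) = sgn (q y)" using agree unfolding Q_def by blast
        then obtain S where S: "matching S" "\<forall>P\<in>snd ` set_mset (M0 + K). sgn_invariant S (P x) (P y)"
          using Q1 unfolding sgn_uniform_def by blast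
        have lead_f: "coeff (f z) n \<noteq> 0" if "z \<in> {x, y}" for z
          using lead[of "(Suc n, f)"] that by (auto simp: M lead_def)
        \<comment> \<open>For \<open>f'\<close> the leading coefficient is \<open>n\<close> times
          that of \<open>f\<close>, nonzero as \<open>n > 0\<close>.\<close>
        have lead_G: "coeff (snd a z) (fst a - 1) \<noteq> 0" if "a \<in># G" "z \<in> {x, y}" for a z
          using that lead[of a] lead_f[of z] high(2)
          by (auto simp: G_def M lead_def f'_def coeff_pderiv)
        \<comment> \<open>The same polynomial may occur with several bounds; any one of these pairs
          supplies a valid remainder.\<close>
        define rep where "rep g = (SOME a. a \<in># G \<and> snd a = g)" for g
        have rep: "rep g \<in># G \<and> snd (rep g) = g" if "g \<in> snd ` set_mset G" for g
        proof -
          have "\<exists>a. a \<in># G \<and> snd a = g" using that by auto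
          then show ?thesis unfolding rep_def by (rule someI_ex)
        qed
        have "\<exists>T. matching T \<and> (\<forall>g\<in>insert f (snd ` set_mset G). sgn_invariant T (g x) (g y))"
        proof (rule sgn_invariant_elimination_step[OF S(1), where R = "\<lambda>g. R (rep g)"])
          show "sgn_invariant S (g x) (g y)" if "g \<in> snd ` set_mset G" for g
            using that S(2) by (auto simp: G_def K_def)
          show "(\<lambda>x. pderiv (f x)) \<in> snd ` set_mset G" by (auto simp: G_def f'_def)
          show "g x \<noteq> 0 \<and> g y \<noteq> 0" if "g \<in> snd ` set_mset G" for g
            using that lead_G by fastforce
          have "degree (f z) \<ge> n" if "z \<in> {x, y}" for z
            using lead_f[OF that] le_degree by blast
          then show "degree (f x) > 0" "degree (f y) > 0" using high(2) by force+
          show "sgn_invariant S (R (rep g) x) (R (rep g) y)" if "g \<in> snd ` set_mset G" for g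
          proof -
            have "R (rep g) \<in> snd ` set_mset (M0 + K)"
              using rep[OF that] by (force simp: K_def image_iff)
            then show ?thesis using S(2) by blast
          qed
          show "sgn (poly (f z) t) = sgn (poly (R (rep g) z) t)"
            if "g \<in> snd ` set_mset G" "z \<in> {x, y}" "poly (g z) t = 0" for g z t
            using R(2)[of "rep g" z t] rep[OF that(1)] lead_G[of "rep g" z] that by auto
        qed
        then show ?thesis by (auto simp: M G_def)
      qed
      moreover have "finite Q" using Q1 Q2 by (simp add: Q_def sgn_uniform_def)
      moreover have "lead a \<in> poly_fun" if "a \<in># M" for a
        using less.prems[of "fst a" "snd a"] that by (simp add: param_poly_def lead_def[abs_def])
      then have "Q \<subseteq> poly_fun" using Q1 Q2 unfolding Q_def sgn_uniform_def by blast
      ultimately have "sgn_uniform (snd ` set_mset M) Q" unfolding sgn_uniform_def by blast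
      then show ?thesis by blast
    qed
  qed
qed

section \<open>Semialgebraic sets and projections\<close>

text \<open>A normal-form-free version of semialgebraicity: complements and intersections become
  immediate, and sign-uniformity applies directly. One implication suffices because the sign
  condition is symmetric in \<open>x\<close> and \<open>y\<close>.\<close>

definition sgn_determined :: "('a::euclidean_space \<Rightarrow> real) set \<Rightarrow> 'a set \<Rightarrow> bool" where
  "sgn_determined Q S \<longleftrightarrow> finite Q \<and> Q \<subseteq> poly_fun \<and>
    (\<forall>x y. (\<forall>q\<in>Q. sgn (q x) = sgn (q y)) \<longrightarrow> x \<in> S \<longrightarrow> y \<in> S)"

lemma basic_semialgebraic_sgn_cell:
  assumes "finite Q" "Q \<subseteq> poly_fun"
  shows "basic_semialgebraic {y. \<forall>q\<in>Q. sgn (q y) = sgn (q x)}"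
proof -
  \<comment> \<open>A sum of squares merges all equations of the sign pattern into the single one
    that a basic set allows.\<close>
  define f where "f y = (\<Sum>q\<in>{q\<in>Q. q x = 0}. q y ^ 2)" for y
  define G where "G = {q\<in>Q. q x > 0} \<union> (\<lambda>q y. - q y) ` {q\<in>Q. q x < 0}"
  have "finite G" using assms by (simp add: G_def)
  then obtain gs where gs: "set gs = G" using finite_list by blast
  have "f \<in> poly_fun" unfolding f_def[abs_def] using assms by (intro poly_fun_intros) auto
  moreover have "g \<in> poly_fun" if "g \<in> set gs" for g
    using that assms by (auto simp: gs G_def intro: poly_fun_uminus)
  moreover have f0: "f y = 0 \<longleftrightarrow> (\<forall>q\<in>Q. q x = 0 \<longrightarrow> q y = 0)" for y
    unfolding f_def using assms by (subst sum_nonneg_eq_0_iff) auto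
  have gs0: "(\<forall>g\<in>set gs. g y > 0) \<longleftrightarrow> (\<forall>q\<in>Q. (q x > 0 \<longrightarrow> q y > 0) \<and> (q x < 0 \<longrightarrow> q y < 0))" for y
    by (simp add: gs G_def ball_Un) blast
  have "sgn (q y) = sgn (q x) \<longleftrightarrow>
      (q x = 0 \<longrightarrow> q y = 0) \<and> (q x > 0 \<longrightarrow> q y > 0) \<and> (q x < 0 \<longrightarrow> q y < 0)" for q :: "'a \<Rightarrow> real" and y
    by (auto simp: sgn_if)
  then have "{y. \<forall>q\<in>Q. sgn (q y) = sgn (q x)} = {y. f y = 0 \<and> (\<forall>g\<in>set gs. g y > 0)}"
    unfolding f0 gs0 by blast
  ultimately show ?thesis unfolding basic_semialgebraic_def by blast
qed

lemma basic_semialgebraic_imp_sgn_determined: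
  assumes "basic_semialgebraic A"
  shows "\<exists>Q. sgn_determined Q A"
proof -
  obtain f gs where fg: "f \<in> poly_fun" "\<forall>g\<in>set gs. g \<in> poly_fun"
      "A = {x. f x = 0 \<and> (\<forall>g\<in>set gs. g x > 0)}"
    using assms unfolding basic_semialgebraic_def by blast
  have "y \<in> A" if agree: "\<forall>q\<in>insert f (set gs). sgn (q x) = sgn (q y)" and "x \<in> A" for x y
  proof -
    have "sgn (f y) = 0" using agree \<open>x \<in> A\<close> by (simp add: fg(3))
    moreover have "g y > 0" if "g \<in> set gs" for g
      using agree \<open>x \<in> A\<close> that fg(3) by (metis (mono_tags, lifting) insertCI mem_Collect_eq sgn_greater)
    ultimately show ?thesis by (simp add: fg(3) sgn_0_0)
  qed
  then have "sgn_determined (insert f (set gs)) A"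
    unfolding sgn_determined_def using fg(1,2) by blast
  then show ?thesis by blast
qed

text \<open>For a finite union the polynomials of all pieces are collected. Conversely, finitely
  many polynomials realise only finitely many sign patterns, and \<open>S\<close> is a union of the
  corresponding cells, each of which is basic.\<close>

lemma semialgebraic_iff_sgn_determined: "semialgebraic S \<longleftrightarrow> (\<exists>Q. sgn_determined Q S)"
proof
  assume "semialgebraic S"
  then obtain \<A> where A: "finite \<A>" "\<forall>A\<in>\<A>. basic_semialgebraic A" "S = \<Union>\<A>"
    by (auto simp: semialgebraic_def)
  then obtain Q where Q: "\<And>A. A \<in> \<A> \<Longrightarrow> sgn_determined (Q A) A"
    using basic_semialgebraic_imp_sgn_determined by metis
  have "y \<in> S" if agree: "\<forall>q\<in>(\<Union>A\<in>\<A>. Q A). sgn (q x) = sgn (q y)" and "x \<in> S" for x y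
  proof -
    obtain C where C: "C \<in> \<A>" "x \<in> C" using \<open>x \<in> S\<close> A by auto
    then have "\<forall>q\<in>Q C. sgn (q x) = sgn (q y)" using agree by blast
    then have "y \<in> C" using Q[OF C(1)] C(2) unfolding sgn_determined_def by blast
    then show ?thesis using C A(3) by blast
  qed
  moreover have "finite (\<Union>A\<in>\<A>. Q A)" "(\<Union>A\<in>\<A>. Q A) \<subseteq> poly_fun"
    using A(1) Q unfolding sgn_determined_def by blast+
  ultimately have "sgn_determined (\<Union>A\<in>\<A>. Q A) S" unfolding sgn_determined_def by blast
  then show "\<exists>Q. sgn_determined Q S" by blast
next
  assume "\<exists>Q. sgn_determined Q S"
  then obtain Q where Q: "finite Q" "Q \<subseteq> poly_fun"
      "\<And>x y. (\<forall>q\<in>Q. sgn (q x) = sgn (q y)) \<Longrightarrow> x \<in> S \<Longrightarrow> y \<in> S"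
    by (auto simp: sgn_determined_def)
  define cell where "cell x = {y. \<forall>q\<in>Q. sgn (q y) = sgn (q x)}" for x
  define pat where "pat x = restrict (\<lambda>q. sgn (q x)) Q" for x
  have "pat x \<in> Q \<rightarrow>\<^sub>E {-1, 0, 1}" for x by (auto simp: pat_def sgn_if)
  then have "finite (range pat)"
    using Q(1) by (intro finite_subset[OF _ finite_PiE[of Q "\<lambda>_. {-1, 0, 1}"]]) auto
  moreover have "cell x = {y. \<forall>q\<in>Q. sgn (q y) = pat x q}" for x by (auto simp: cell_def pat_def)
  then have "range cell = (\<lambda>p. {y. \<forall>q\<in>Q. sgn (q y) = p q}) ` range pat" by (simp add: image_image)
  ultimately have "finite (range cell)" by simp
  then have "finite (cell ` S)" by (rule finite_subset[rotated]) auto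
  moreover have "y \<in> S" if "x \<in> S" "y \<in> cell x" for x y
    using Q(3)[of x y] that by (simp add: cell_def)
  then have "S = \<Union>(cell ` S)" by (auto simp: cell_def)
  moreover have "basic_semialgebraic A" if "A \<in> cell ` S" for A
    using that basic_semialgebraic_sgn_cell[OF Q(1,2)] by (auto simp: cell_def)
  ultimately show "semialgebraic S" unfolding semialgebraic_def by blast
qed

lemma semialgebraic_Compl:
  assumes "semialgebraic S" shows "semialgebraic (- S)"
proof -
  obtain Q where "sgn_determined Q S" using assms semialgebraic_iff_sgn_determined by blast
  then have "sgn_determined Q (- S)" unfolding sgn_determined_def by (metis ComplD ComplI)
  then show ?thesis using semialgebraic_iff_sgn_determined by blast
qed

lemma semialgebraic_Int:
  assumes "semialgebraic S" "semialgebraic T" shows "semialgebraic (S \<inter> T)"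
proof -
  obtain Q R where "sgn_determined Q S" "sgn_determined R T"
    using assms semialgebraic_iff_sgn_determined by blast
  then have "sgn_determined (Q \<union> R) (S \<inter> T)" unfolding sgn_determined_def
    by (metis (no_types, lifting) IntE IntI UnCI finite_UnI le_sup_iff)
  then show ?thesis using semialgebraic_iff_sgn_determined by blast
qed

section \<open>Sets described by formulas\<close>

lemma semialgebraic_Collect_not: "semialgebraic {x. P x} \<Longrightarrow> semialgebraic {x. \<not> P x}"
  using semialgebraic_Compl by (fastforce simp: Collect_neg_eq)

lemma semialgebraic_Collect_conj:
  "semialgebraic {x. P x} \<Longrightarrow> semialgebraic {x. R x} \<Longrightarrow> semialgebraic {x. P x \<and> R x}"
  using semialgebraic_Int by (fastforce simp: Collect_conj_eq)

lemma semialgebraic_Collect_imp: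
  "semialgebraic {x. P x} \<Longrightarrow> semialgebraic {x. R x} \<Longrightarrow> semialgebraic {x. P x \<longrightarrow> R x}"
  using semialgebraic_Collect_not[OF semialgebraic_Collect_conj[of P "\<lambda>x. \<not> R x"]]
    semialgebraic_Collect_not[of R] by simp

lemma semialgebraic_positive: "p \<in> poly_fun \<Longrightarrow> semialgebraic {x. p x > 0}"
  unfolding semialgebraic_iff_sgn_determined sgn_determined_def
  by (intro exI[of _ "{p}"]) (auto simp: sgn_if split: if_splits)

lemma semialgebraic_zero: "p \<in> poly_fun \<Longrightarrow> semialgebraic {x. p x = 0}"
  unfolding semialgebraic_iff_sgn_determined sgn_determined_def
  by (intro exI[of _ "{p}"]) (auto simp: sgn_if split: if_splits)

definition poly_map :: "('a::euclidean_space \<Rightarrow> 'b::euclidean_space) \<Rightarrow> bool" where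
  "poly_map h \<longleftrightarrow> (\<forall>b\<in>Basis. (\<lambda>x. h x \<bullet> b) \<in> poly_fun)"

lemma poly_fun_compose:
  assumes "p \<in> poly_fun" "poly_map h"
  shows "(\<lambda>x. p (h x)) \<in> poly_fun"
  using assms(1) by induction (use assms(2) in \<open>auto simp: poly_map_def intro: poly_fun.intros\<close>)

lemma poly_fun_linear:
  fixes f :: "'a::euclidean_space \<Rightarrow> real"
  assumes "linear f" shows "f \<in> poly_fun"
proof -
  have "f = (\<lambda>x. \<Sum>b\<in>Basis. (x \<bullet> b) * f b)"
  proof
    fix x
    have "f x = f (\<Sum>b\<in>Basis. (x \<bullet> b) *\<^sub>R b)" by (simp add: euclidean_representation)
    also have "\<dots> = (\<Sum>b\<in>Basis. (x \<bullet> b) * f b)"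
      using assms by (simp add: linear_sum linear_scale)
    finally show "f x = (\<Sum>b\<in>Basis. (x \<bullet> b) * f b)" .
  qed
  also have "\<dots> \<in> poly_fun" by (intro poly_fun_intros)
  finally show ?thesis .
qed

lemma poly_map_linear:
  assumes "linear h" shows "poly_map h"
proof -
  have "linear (\<lambda>x. h x \<bullet> b)" for b
    using assms by (auto simp: linear_iff inner_add_left)
  then show ?thesis unfolding poly_map_def by (auto intro: poly_fun_linear)
qed

lemma semialgebraic_vimage:
  assumes "semialgebraic S" "poly_map h" shows "semialgebraic {x. h x \<in> S}"
proof -
  obtain Q where "sgn_determined Q S" using assms semialgebraic_iff_sgn_determined by blast
  then have "sgn_determined ((\<lambda>q x. q (h x)) ` Q) {x. h x \<in> S}"
    unfolding sgn_determined_def using assms(2) by (auto intro: poly_fun_compose)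
  then show ?thesis using semialgebraic_iff_sgn_determined by blast
qed

section \<open>Restriction to parallel lines and elimination of quantifiers\<close>

lemma param_poly_mult:
  assumes "P \<in> param_poly m" "R \<in> param_poly n"
  shows "(\<lambda>x. P x * R x) \<in> param_poly (m + n)"
proof -
  have "(\<lambda>x. coeff (P x * R x) i) \<in> poly_fun" for i
    unfolding coeff_mult using assms by (intro poly_fun_intros) (auto simp: param_poly_def)
  moreover have "coeff (P x * R x) i = 0" if "i \<ge> m + n" for x i
    unfolding coeff_mult
  proof (intro sum.neutral ballI)
    fix j assume "j \<in> {..i}"
    have "j \<ge> m \<or> i - j \<ge> n" using that by auto
    then show "coeff (P x) j * coeff (R x) (i - j) = 0" using assms by (auto simp: param_poly_def)
  qed
  ultimately show ?thesis unfolding param_poly_def by blast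
qed

lemma param_poly_add:
  assumes "P \<in> param_poly m" "R \<in> param_poly n"
  shows "(\<lambda>x. P x + R x) \<in> param_poly (max m n)"
  using assms by (auto simp: param_poly_def intro: poly_fun_intros)

lemma poly_fun_on_line:
  assumes "p \<in> poly_fun"
  shows "\<exists>n. \<exists>P\<in>param_poly n. \<forall>z t. p (z + t *\<^sub>R v) = poly (P z) t"
  using assms
proof induction
  case (const c)
  have "(\<lambda>x. [:c:]) \<in> param_poly 1"
    by (auto simp: param_poly_def coeff_pCons intro: poly_fun_intros split: nat.splits)
  then show ?case by (intro exI bexI[rotated]) auto
next
  case (coord b)
  have "(\<lambda>x. coeff [:x \<bullet> b, v \<bullet> b:] i) \<in> poly_fun" for i
    by (cases i) (auto simp: coeff_pCons intro: poly_fun_intros coord split: nat.splits)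
  then have "(\<lambda>x. [:x \<bullet> b, v \<bullet> b:]) \<in> param_poly 2"
    unfolding param_poly_def by (auto simp: coeff_pCons split: nat.splits)
  then show ?case by (intro exI bexI[rotated]) (auto simp: inner_add_left)
next
  case (add p q)
  then obtain m n P R where "P \<in> param_poly m" "R \<in> param_poly n"
    "\<forall>z t. p (z + t *\<^sub>R v) = poly (P z) t" "\<forall>z t. q (z + t *\<^sub>R v) = poly (R z) t" by blast
  then show ?case
    by (intro exI[of _ "max m n"] bexI[of _ "\<lambda>z. P z + R z"] param_poly_add) simp_all
next
  case (mult p q)
  then obtain m n P R where "P \<in> param_poly m" "R \<in> param_poly n"
    "\<forall>z t. p (z + t *\<^sub>R v) = poly (P z) t" "\<forall>z t. q (z + t *\<^sub>R v) = poly (R z) t" by blast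
  then show ?case
    by (intro exI[of _ "m + n"] bexI[of _ "\<lambda>z. P z * R z"] param_poly_mult) simp_all
qed

text \<open>If \<open>x\<close> and \<open>y\<close> agree in the signs of \<open>Q\<close>, the
  lines through them in direction \<open>v\<close> have matched cells. The partner \<open>t'\<close>
  of a parameter \<open>t\<close> then gives \<open>y + t' *\<^sub>R v\<close> the signs of
  \<open>x + t *\<^sub>R v\<close>, and membership in \<open>S\<close> depends on these signs
  only.\<close>

lemma semialgebraic_line_sum:
  assumes "semialgebraic S"
  shows "semialgebraic {z. \<exists>t. z + t *\<^sub>R v \<in> S}"
proof -
  obtain Q0 where Q0: "finite Q0" "Q0 \<subseteq> poly_fun"
      "\<And>x y. (\<forall>q\<in>Q0. sgn (q x) = sgn (q y)) \<Longrightarrow> x \<in> S \<Longrightarrow> y \<in> S"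
    using assms by (auto simp: semialgebraic_iff_sgn_determined sgn_determined_def)
  have "\<forall>q\<in>Q0. \<exists>n P. P \<in> param_poly n \<and> (\<forall>z t. q (z + t *\<^sub>R v) = poly (P z) t)"
    using poly_fun_on_line Q0(2) by blast
  then obtain n P where P: "\<And>q. q \<in> Q0 \<Longrightarrow> P q \<in> param_poly (n q)"
      "\<And>q z t. q \<in> Q0 \<Longrightarrow> q (z + t *\<^sub>R v) = poly (P q z) t" by metis
  define M where "M = image_mset (\<lambda>q. (n q, P q)) (mset_set Q0)"
  have "\<exists>Q. sgn_uniform (snd ` set_mset M) Q"
    using P(1) Q0(1) by (intro sgn_uniform_exists) (auto simp: M_def)
  then obtain Q where Q: "finite Q" "Q \<subseteq> poly_fun"
      "\<And>x y. (\<forall>q\<in>Q. sgn (q x) = sgn (q y)) \<Longrightarrow>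
        \<exists>T. matching T \<and> (\<forall>q\<in>Q0. sgn_invariant T (P q x) (P q y))"
    using Q0(1) by (auto simp: sgn_uniform_def M_def)
  have "\<exists>t. y + t *\<^sub>R v \<in> S" if x: "\<forall>q\<in>Q. sgn (q x) = sgn (q y)" "x + t *\<^sub>R v \<in> S" for x y t
  proof -
    obtain T where T: "matching T" "\<forall>q\<in>Q0. sgn_invariant T (P q x) (P q y)"
      using Q(3) x(1) by blast
    obtain t' where "same_cell T t t'" using same_cell_exists T(1) by blast
    then have "\<forall>q\<in>Q0. sgn (q (x + t *\<^sub>R v)) = sgn (q (y + t' *\<^sub>R v))"
      using T(2) P(2) sgn_invariantD by metis
    then show ?thesis using Q0(3) x(2) by blast
  qed
  then have "sgn_determined Q {z. \<exists>t. z + t *\<^sub>R v \<in> S}"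
    unfolding sgn_determined_def using Q(1,2) by blast
  then show ?thesis using semialgebraic_iff_sgn_determined by blast
qed

lemma add_span_insert_eq:
  fixes v :: "'i \<Rightarrow> 'a::real_vector"
  assumes "finite I" "j \<notin> I"
  shows "(\<exists>c. z + (\<Sum>i\<in>insert j I. c i *\<^sub>R v i) \<in> S) \<longleftrightarrow>
    (\<exists>t c. (z + t *\<^sub>R v j) + (\<Sum>i\<in>I. c i *\<^sub>R v i) \<in> S)"
proof safe
  fix c assume "z + (\<Sum>i\<in>insert j I. c i *\<^sub>R v i) \<in> S"
  then show "\<exists>t c. (z + t *\<^sub>R v j) + (\<Sum>i\<in>I. c i *\<^sub>R v i) \<in> S"
    using assms by (intro exI[of _ "c j"] exI[of _ c]) (simp add: add.assoc)
next
  fix t c assume *: "(z + t *\<^sub>R v j) + (\<Sum>i\<in>I. c i *\<^sub>R v i) \<in> S"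
  have "(\<Sum>i\<in>I. (c(j := t)) i *\<^sub>R v i) = (\<Sum>i\<in>I. c i *\<^sub>R v i)"
    using assms by (intro sum.cong) auto
  then show "\<exists>c. z + (\<Sum>i\<in>insert j I. c i *\<^sub>R v i) \<in> S"
    using * assms by (intro exI[of _ "c(j := t)"]) (simp add: add.assoc)
qed

lemma semialgebraic_span_sum:
  fixes v :: "'i \<Rightarrow> 'a::euclidean_space"
  assumes "finite I" "semialgebraic S"
  shows "semialgebraic {z. \<exists>c. z + (\<Sum>i\<in>I. c i *\<^sub>R v i) \<in> S}"
  using assms(1)
proof induction
  case empty
  then show ?case using assms(2) by simp
next
  case (insert j I)
  then show ?case using semialgebraic_line_sum[OF insert.IH, of "v j"]
    by (simp only: add_span_insert_eq[OF insert.hyps(1,2)] mem_Collect_eq)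
qed

text \<open>The projection is the slice at second coordinate 0 of the sum of \<open>S\<close> with
  all the lines spanned by the second factor.\<close>

theorem semialgebraic_projection:
  fixes S :: "('a::euclidean_space \<times> 'b::euclidean_space) set"
  assumes "semialgebraic S"
  shows "semialgebraic {x. \<exists>y. (x, y) \<in> S}"
proof -
  have "(\<exists>c. (x, 0) + (\<Sum>b\<in>(Basis :: 'b set). c b *\<^sub>R (0, b)) \<in> S) \<longleftrightarrow> (\<exists>y. (x, y) \<in> S)" for x
  proof -
    have eq: "(x, 0) + (\<Sum>b\<in>(Basis :: 'b set). c b *\<^sub>R (0, b)) = (x, \<Sum>b\<in>Basis. c b *\<^sub>R b)" for c :: "'b \<Rightarrow> real"
      by (simp add: prod_eq_iff fst_sum snd_sum)
    show ?thesis unfolding eq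
    proof
      assume "\<exists>y. (x, y) \<in> S"
      then obtain y where "(x, y) \<in> S" by blast
      then show "\<exists>c. (x, \<Sum>b\<in>(Basis :: 'b set). c b *\<^sub>R b) \<in> S"
        by (intro exI[of _ "\<lambda>b. y \<bullet> b"]) (simp add: euclidean_representation)
    qed blast
  qed
  moreover have "poly_map (\<lambda>x::'a. (x, 0::'b))" by (intro poly_map_linear) (simp add: linear_iff)
  ultimately show ?thesis
    using semialgebraic_vimage[OF semialgebraic_span_sum[OF finite_Basis assms, of "\<lambda>b. (0, b)"],
        of "\<lambda>x. (x, 0)"] by simp
qed

lemma semialgebraic_Collect_ex:
  assumes "semialgebraic {(x, y). P x y}" shows "semialgebraic {x. \<exists>y. P x y}"
  using semialgebraic_projection[OF assms] by simp

lemma semialgebraic_Collect_all: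
  assumes "semialgebraic {(x, y). P x y}" shows "semialgebraic {x. \<forall>y. P x y}"
  using semialgebraic_Collect_not[OF semialgebraic_Collect_ex[of "\<lambda>x y. \<not> P x y"]]
    semialgebraic_Collect_not[of "\<lambda>(x, y). P x y"] assms by (simp add: case_prod_unfold)

text \<open>Closedness says that every point approximable from the set lies in it, a first-order
  condition. The radius enters through its square \<open>e\<close>, which keeps the inequality
  polynomial.\<close>

lemma semialgebraic_fibrewise_closed:
  fixes D :: "('a::euclidean_space \<times> 'b::euclidean_space) set"
  assumes "semialgebraic D"
  shows "semialgebraic {x. closed {y. (x, y) \<in> D}}"
proof -
  have closed_iff: "closed C \<longleftrightarrow>
      (\<forall>y. (\<forall>e>0. \<exists>z. z \<in> C \<and> e - (y - z) \<bullet> (y - z) > 0) \<longrightarrow> y \<in> C)" for C :: "'b set"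
  proof -
    have "y \<in> closure C \<longleftrightarrow> (\<forall>e>0. \<exists>z. z \<in> C \<and> e - (y - z) \<bullet> (y - z) > 0)" for y
    proof -
      have "(\<exists>z\<in>C. dist z y < d) \<longleftrightarrow> (\<exists>z. z \<in> C \<and> d\<^sup>2 - (y - z) \<bullet> (y - z) > 0)" if "d > 0" for d
      proof -
        have "dist z y < d \<longleftrightarrow> d\<^sup>2 - (y - z) \<bullet> (y - z) > 0" for z
          using that abs_less_iff[of "norm (y - z)" d] power2_less_imp_less[of "norm (y - z)" d]
            power_strict_mono[of "norm (y - z)" d 2]
          by (auto simp: dist_norm norm_minus_commute dot_square_norm)
        then show ?thesis by blast
      qed
      then show ?thesis unfolding closure_approachable
        by (metis real_sqrt_gt_0_iff real_sqrt_pow2 less_imp_le zero_less_power)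
    qed
    then show ?thesis by (metis closed_closure closure_closed closure_subset subsetI subset_antisym)
  qed
  \<comment> \<open>The variables are nested as \<open>(((x, y), e), z)\<close>, so that the
    quantifiers over \<open>z\<close>, \<open>e\<close> and \<open>y\<close> remove the last
    component in turn.\<close>
  let ?u = "\<lambda>p :: (('a \<times> 'b) \<times> real) \<times> 'b. snd (fst (fst p)) - snd p"
  have "(\<lambda>p. snd (fst p) - (\<Sum>b\<in>Basis. (?u p \<bullet> b) * (?u p \<bullet> b))) \<in> poly_fun"
    by (intro poly_fun_diff poly_fun_sum poly_fun.mult poly_fun_linear)
       (auto simp: linear_iff inner_simps algebra_simps)
  then have "semialgebraic {p. snd (fst p) - ?u p \<bullet> ?u p > 0}"
    by (subst euclidean_inner) (rule semialgebraic_positive)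
  moreover have "poly_map (\<lambda>p :: (('a \<times> 'b) \<times> real) \<times> 'b. (fst (fst (fst p)), snd p))"
    by (intro poly_map_linear) (simp add: linear_iff)
  ultimately have "semialgebraic {p. (fst (fst (fst p)), snd p) \<in> D \<and> snd (fst p) - ?u p \<bullet> ?u p > 0}"
    using semialgebraic_vimage[OF assms] by (intro semialgebraic_Collect_conj) blast+
  then have "semialgebraic {q :: ('a \<times> 'b) \<times> real. \<exists>z. (fst (fst q), z) \<in> D \<and>
      snd q - (snd (fst q) - z) \<bullet> (snd (fst q) - z) > 0}"
    by (intro semialgebraic_Collect_ex) (simp add: case_prod_unfold)
  moreover have "semialgebraic {q :: ('a \<times> 'b) \<times> real. snd q > 0}"
    by (intro semialgebraic_positive poly_fun_linear) (simp add: linear_iff)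
  ultimately have "semialgebraic {q :: ('a \<times> 'b) \<times> real. snd q > 0 \<longrightarrow> (\<exists>z. (fst (fst q), z) \<in> D \<and>
      snd q - (snd (fst q) - z) \<bullet> (snd (fst q) - z) > 0)}"
    by (rule semialgebraic_Collect_imp[rotated])
  then have "semialgebraic {r :: 'a \<times> 'b. \<forall>e. e > 0 \<longrightarrow> (\<exists>z. (fst r, z) \<in> D \<and>
      e - (snd r - z) \<bullet> (snd r - z) > 0)}"
    by (intro semialgebraic_Collect_all) (simp add: case_prod_unfold)
  then have "semialgebraic {r :: 'a \<times> 'b. (\<forall>e. e > 0 \<longrightarrow> (\<exists>z. (fst r, z) \<in> D \<and>
      e - (snd r - z) \<bullet> (snd r - z) > 0)) \<longrightarrow> r \<in> D}"
    using assms by (intro semialgebraic_Collect_imp) simp_all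
  then have "semialgebraic {x. \<forall>y. (\<forall>e. e > 0 \<longrightarrow> (\<exists>z. (x, z) \<in> D \<and>
      e - (y - z) \<bullet> (y - z) > 0)) \<longrightarrow> (x, y) \<in> D}"
    by (intro semialgebraic_Collect_all) (simp add: case_prod_unfold)
  then show ?thesis unfolding closed_iff by simp
qed

section \<open>Projections along generic directions\<close>

lemma continuous_on_poly_fun: "p \<in> poly_fun \<Longrightarrow> continuous_on S p"
  by (induction rule: poly_fun.induct) (auto intro: continuous_intros)

text \<open>On the line from \<open>a\<close> to \<open>x\<close> the polynomial vanishes near
  \<open>a\<close>, so it has infinitely many roots there and vanishes also at
  \<open>x\<close>.\<close>

lemma poly_fun_eq_0_if_open:
  assumes "p \<in> poly_fun" "open U" "a \<in> U" "\<And>x. x \<in> U \<Longrightarrow> p x = 0"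
  shows "p x = 0"
proof -
  obtain n P where P: "\<forall>z t. p (z + t *\<^sub>R (x - a)) = poly (P z) t"
    using poly_fun_on_line[OF assms(1), of "x - a"] by blast
  have "open ((\<lambda>t. a + t *\<^sub>R (x - a)) -` U)"
    using assms(2) by (intro open_vimage continuous_intros)
  then obtain e where e: "e > 0" "ball 0 e \<subseteq> (\<lambda>t. a + t *\<^sub>R (x - a)) -` U"
    using assms(3) by (force simp: open_contains_ball)
  have "poly (P a) t = 0" if "t \<in> {0<..<e}" for t
  proof -
    have "a + t *\<^sub>R (x - a) \<in> U" using e(2) that by (auto simp: subset_iff)
    then show ?thesis using P assms(4) by metis
  qed
  then have "{0<..<e} \<subseteq> {t. poly (P a) t = 0}" by blast
  moreover have "infinite {0<..<e}" using e(1) by (simp add: infinite_Ioo)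
  ultimately have "P a = 0" using poly_roots_finite finite_subset by blast
  then show ?thesis using P[rule_format, of a 1] by simp
qed

lemma poly_fun_mult_nonzero:
  assumes "p \<in> poly_fun" "q \<in> poly_fun" "p a \<noteq> 0" "q b \<noteq> 0"
  shows "\<exists>x. p x * q x \<noteq> 0"
proof (rule ccontr)
  assume "\<nexists>x. p x * q x \<noteq> 0"
  then have 0: "p x * q x = 0" for x by blast
  have "open {x. p x \<noteq> 0}"
    using continuous_on_poly_fun[OF assms(1)] by (intro open_Collect_neq) auto
  then have "q b = 0"
  proof (rule poly_fun_eq_0_if_open[OF assms(2)])
    show "a \<in> {x. p x \<noteq> 0}" using assms(3) by simp
    show "q x = 0" if "x \<in> {x. p x \<noteq> 0}" for x using 0[of x] that by simp
  qed
  then show False using assms by simp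
qed

lemma poly_fun_prod_nonzero:
  assumes "finite Q" "\<And>q. q \<in> Q \<Longrightarrow> q \<in> poly_fun \<and> (\<exists>x. q x \<noteq> 0)"
  shows "\<exists>x. (\<Prod>q\<in>Q. q x) \<noteq> 0"
  using assms
proof (induction Q)
  case empty
  then show ?case by simp
next
  case (insert q Q)
  then obtain a b where "q a \<noteq> 0" "(\<Prod>q\<in>Q. q b) \<noteq> 0" by blast
  moreover have "(\<lambda>x. \<Prod>q\<in>Q. q x) \<in> poly_fun" using insert.prems by (intro poly_fun_prod) blast
  ultimately have "\<exists>x. q x * (\<Prod>q\<in>Q. q x) \<noteq> 0"
    using insert.prems by (intro poly_fun_mult_nonzero) auto
  then show ?case using insert.hyps by simp
qed

text \<open>Where all defining polynomials are nonzero their signs are locally constant, so a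
  neighbourhood lies inside \<open>Y\<close> or outside. The identically zero ones never change sign
  and are left out, which keeps the product \<open>f\<close> nonzero.\<close>

lemma frontier_semialgebraic_subset_zeros:
  assumes "semialgebraic Y"
  obtains f where "f \<in> poly_fun" "\<exists>x. f x \<noteq> 0" "frontier Y \<subseteq> {x. f x = 0}"
proof -
  obtain Q where Q: "finite Q" "Q \<subseteq> poly_fun"
      "\<And>x y. (\<forall>q\<in>Q. sgn (q x) = sgn (q y)) \<Longrightarrow> x \<in> Y \<Longrightarrow> y \<in> Y"
    using assms by (auto simp: semialgebraic_iff_sgn_determined sgn_determined_def)
  define Q' where "Q' = {q\<in>Q. \<exists>x. q x \<noteq> 0}"
  define f where "f x = (\<Prod>q\<in>Q'. q x)" for x
  have fin: "finite Q'" using Q by (simp add: Q'_def)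
  have "f \<in> poly_fun" unfolding f_def[abs_def] using Q(2) by (intro poly_fun_prod) (auto simp: Q'_def)
  moreover have "\<exists>x. f x \<noteq> 0"
    unfolding f_def using fin Q(2) by (intro poly_fun_prod_nonzero) (auto simp: Q'_def)
  moreover have "f x = 0" if x: "x \<in> frontier Y" for x
  proof (rule ccontr)
    assume "f x \<noteq> 0"
    then have nz: "q x \<noteq> 0" if "q \<in> Q'" for q using that fin by (auto simp: f_def)
    define U where "U = (\<Inter>q\<in>Q'. {y. q x * q y > 0})"
    have "open {y. q x * q y > 0}" if "q \<in> Q'" for q
      using that Q(2) by (intro open_Collect_less continuous_intros continuous_on_poly_fun) (auto simp: Q'_def)
    then have U: "open U" using fin by (auto simp: U_def)
    have "x \<in> U" using nz by (auto simp: U_def zero_less_mult_iff linorder_neq_iff)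
    have sgn: "sgn (q y) = sgn (q x)" if "q \<in> Q" "y \<in> U" for q y
    proof (cases "q \<in> Q'")
      case True
      then have "q x * q y > 0" using that(2) by (auto simp: U_def)
      then show ?thesis by (auto simp: sgn_if zero_less_mult_iff)
    next
      case False
      then have "q z = 0" for z using that(1) unfolding Q'_def by blast
      then show ?thesis by simp
    qed
    have "y \<in> Y \<longleftrightarrow> x \<in> Y" if "y \<in> U" for y
      using Q(3)[of x y] Q(3)[of y x] sgn[OF _ that] by auto
    then have "U \<subseteq> Y \<or> U \<subseteq> - Y" by blast
    then have "x \<in> interior Y \<or> x \<in> interior (- Y)" using U \<open>x \<in> U\<close> interior_maximal by blast
    then show False using x by (auto simp: frontier_def closure_interior)
  qed
  ultimately show ?thesis using that by blast
qed

section \<open>Leading forms and behaviour at infinity\<close>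

definition homogeneous_sum ::
    "('a::euclidean_space \<Rightarrow> real) \<Rightarrow> nat \<Rightarrow> (nat \<Rightarrow> 'a \<Rightarrow> real) \<Rightarrow> bool" where
  "homogeneous_sum p d F \<longleftrightarrow>
    (\<forall>k. F k \<in> poly_fun \<and> (\<forall>s x. F k (s *\<^sub>R x) = s ^ k * F k x)) \<and>
    (\<forall>k>d. \<forall>x. F k x = 0) \<and> (\<forall>x. p x = (\<Sum>k\<le>d. F k x))"

lemma homogeneous_sumD:
  assumes "homogeneous_sum p d F"
  shows "F k \<in> poly_fun" "F k (s *\<^sub>R x) = s ^ k * F k x" "k > d \<Longrightarrow> F k x = 0"
    "p x = (\<Sum>k\<le>d. F k x)"
  using assms unfolding homogeneous_sum_def by blast+

text \<open>Since \<open>d\<close> is only an upper bound and all components beyond it vanish, two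
  decompositions can be padded to a common bound, and the components of a product form a Cauchy
  product.\<close>

lemma poly_fun_homogeneous_sum:
  assumes "p \<in> poly_fun"
  shows "\<exists>d F. homogeneous_sum p d F"
  using assms
proof induction
  case (const c)
  show ?case unfolding homogeneous_sum_def
    by (rule exI[of _ 0], rule exI[of _ "\<lambda>k x. if k = 0 then c else 0"])
       (auto intro: poly_fun_intros)
next
  case (coord b)
  have "(\<lambda>x. if k = 1 then x \<bullet> b else 0) \<in> poly_fun" for k :: nat
    using coord by (cases "k = 1") (auto intro: poly_fun_intros)
  then show ?case unfolding homogeneous_sum_def
    by (intro exI[of _ 1] exI[of _ "\<lambda>k x. if k = 1 then x \<bullet> b else 0"]) auto
next
  case (add p q)
  then obtain d F e G where "homogeneous_sum p d F" "homogeneous_sum q e G" by blast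
  note F = homogeneous_sumD[OF this(1)] and G = homogeneous_sumD[OF this(2)]
  have "p x = (\<Sum>k\<le>max d e. F k x)" "q x = (\<Sum>k\<le>max d e. G k x)" for x
    unfolding F(4) G(4) by (intro sum.mono_neutral_left; use F(3) G(3) in auto)+
  then have "homogeneous_sum (\<lambda>x. p x + q x) (max d e) (\<lambda>k x. F k x + G k x)"
    unfolding homogeneous_sum_def
    by (simp add: F(1-3) G(1-3) sum.distrib distrib_left poly_fun.add)
  then show ?case by blast
next
  case (mult p q)
  then obtain d F e G where "homogeneous_sum p d F" "homogeneous_sum q e G" by blast
  note F = homogeneous_sumD[OF this(1)] and G = homogeneous_sumD[OF this(2)]
  define H where "H k x = (\<Sum>i\<le>k. F i x * G (k - i) x)" for k x
  have "H k \<in> poly_fun" for k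
    unfolding H_def[abs_def] using F(1) G(1) by (intro poly_fun_intros)
  moreover have "H k (s *\<^sub>R x) = s ^ k * H k x" for k s x
    unfolding H_def sum_distrib_left F(2) G(2)
  proof (intro sum.cong refl)
    fix i assume "i \<in> {..k}"
    then have "s ^ k = s ^ i * s ^ (k - i)" by (simp flip: power_add)
    then show "s ^ i * F i x * (s ^ (k - i) * G (k - i) x) = s ^ k * (F i x * G (k - i) x)"
      by (simp add: algebra_simps)
  qed
  moreover have "H k x = 0" if k: "k > d + e" for k x
    unfolding H_def
  proof (intro sum.neutral ballI)
    fix i assume "i \<in> {..k}"
    have "i > d \<or> k - i > e" using k by auto
    then show "F i x * G (k - i) x = 0" using F(3) G(3) by auto
  qed
  moreover have "p x * q x = (\<Sum>k\<le>d + e. H k x)" for x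
    using polynomial_product[of d "\<lambda>k. F k x" e "\<lambda>k. G k x" 1] F(3) G(3) by (simp add: F(4) G(4) H_def)
  ultimately have "homogeneous_sum (\<lambda>x. p x * q x) (d + e) H"
    unfolding homogeneous_sum_def by blast
  then show ?case by blast
qed

text \<open>The form \<open>h\<close> is the highest nonzero homogeneous component
  \<open>F d\<close>. For large \<open>t\<close> and bounded \<open>p\<close>, the quotient of
  \<open>f (p + t *\<^sub>R v)\<close> by \<open>t ^ d\<close> is close to
  \<open>h v\<close>.\<close>

lemma poly_fun_leading_form:
  assumes "f \<in> poly_fun" "f x0 \<noteq> 0"
  obtains h where "h \<in> poly_fun" "\<exists>x. h x \<noteq> 0"
    "\<And>v r. h v \<noteq> 0 \<Longrightarrow> \<exists>m. \<forall>p t. norm p \<le> r \<longrightarrow> \<bar>t\<bar> \<ge> m \<longrightarrow> f (p + t *\<^sub>R v) \<noteq> 0"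
proof -
  obtain d0 F where "homogeneous_sum f d0 F" using poly_fun_homogeneous_sum[OF assms(1)] by blast
  note F = homogeneous_sumD[OF this]
  define K where "K = {k. k \<le> d0 \<and> (\<exists>x. F k x \<noteq> 0)}"
  define d where "d = Max K"
  have "finite K" by (simp add: K_def)
  have "K \<noteq> {}"
  proof
    assume "K = {}"
    then have "F k x0 = 0" if "k \<le> d0" for k using that by (auto simp: K_def)
    then show False using assms(2) F(4)[of x0] by simp
  qed
  then have dK: "d \<in> K" using \<open>finite K\<close> by (simp add: d_def)
  have d: "F k x = 0" if "k > d" for k x
  proof (rule ccontr)
    assume "F k x \<noteq> 0"
    then have "k \<in> K" using F(3)[of k x] by (force simp: K_def not_less)
    then have "k \<le> d" using \<open>finite K\<close> by (simp add: d_def)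
    then show False using that by simp
  qed
  have f: "f x = (\<Sum>k\<le>d. F k x)" for x
    unfolding F(4) by (rule sum.mono_neutral_right) (use d dK in \<open>auto simp: K_def\<close>)
  have "\<exists>m. \<forall>p t. norm p \<le> r \<longrightarrow> \<bar>t\<bar> \<ge> m \<longrightarrow> f (p + t *\<^sub>R v) \<noteq> 0" if v: "F d v \<noteq> 0" for v r
  proof -
    \<comment> \<open>This is that quotient in the coordinates \<open>1 / t\<close> and
      \<open>(1 / t) *\<^sub>R p\<close>. It extends continuously to infinity, which has become the
      origin, with value \<open>F d v\<close>.\<close>
    define g where "g z = (\<Sum>k\<le>d. fst z ^ (d - k) * F k (snd z + v))" for z :: "real \<times> 'a"
    have cF: "continuous_on UNIV (F k)" for k using F(1) continuous_on_poly_fun by blast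
    have "continuous_on UNIV (\<lambda>z :: real \<times> 'a. F k (snd z + v))" for k
      by (rule continuous_on_compose2[OF cF]) (auto intro!: continuous_intros)
    then have "continuous_on UNIV g"
      unfolding g_def[abs_def] by (intro continuous_intros)
    then have "continuous (at (0, 0)) g" by (simp add: continuous_on_eq_continuous_at)
    moreover have "g (0, 0) = (\<Sum>k\<le>d. if k = d then F d v else 0)"
      unfolding g_def by (intro sum.cong) (auto simp: power_0_left)
    then have "g (0, 0) \<noteq> 0" using v by simp
    ultimately obtain \<delta> where \<delta>: "\<delta> > 0" "\<And>z. dist (0, 0) z < \<delta> \<Longrightarrow> g z \<noteq> 0"
      using continuous_at_avoid[of "(0, 0)" g 0] by auto
    \<comment> \<open>The quotient bounds \<open>(1 + norm p) / \<bar>t\<bar>\<close> by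
      \<open>\<delta>\<close>; the summand 1 makes the inequality strict.\<close>
    define m where "m = (1 + \<bar>r\<bar>) / \<delta> + 1"
    have "f (p + t *\<^sub>R v) \<noteq> 0" if pt: "norm p \<le> r" "\<bar>t\<bar> \<ge> m" for p t
    proof -
      have "(1 + \<bar>r\<bar>) / \<delta> > 0" using \<delta>(1) by simp
      then have t: "\<bar>t\<bar> > 0" "\<bar>t\<bar> > (1 + \<bar>r\<bar>) / \<delta>" using pt(2) by (auto simp: m_def)
      have "norm (1 / t, (1 / t) *\<^sub>R p) \<le> \<bar>1 / t\<bar> + norm ((1 / t) *\<^sub>R p)"
        by (rule order_trans[OF norm_Pair_le]) simp
      also have "\<dots> = (1 + norm p) / \<bar>t\<bar>" by (simp add: add_divide_distrib)
      also have "\<dots> \<le> (1 + \<bar>r\<bar>) / \<bar>t\<bar>" using pt(1) by (intro divide_right_mono) auto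
      also have "\<dots> < \<delta>" using t \<delta>(1) by (simp add: field_simps)
      finally have "g (1 / t, (1 / t) *\<^sub>R p) \<noteq> 0"
        by (intro \<delta>(2)) (simp only: dist_0_norm flip: zero_prod_def)
      moreover have "f (p + t *\<^sub>R v) = t ^ d * g (1 / t, (1 / t) *\<^sub>R p)"
        unfolding f g_def sum_distrib_left
      proof (intro sum.cong refl)
        fix k assume k: "k \<in> {..d}"
        have eq: "p + t *\<^sub>R v = t *\<^sub>R ((1 / t) *\<^sub>R p + v)" using t(1) by (simp add: scaleR_add_right)
        have "t ^ d = t ^ k * t ^ (d - k)" using k by (simp flip: power_add)
        then have "t ^ d * (1 / t) ^ (d - k) = t ^ k" using t(1) by (simp add: power_one_over)
        then show "F k (p + t *\<^sub>R v) = t ^ d * (fst (1 / t, (1 / t) *\<^sub>R p) ^ (d - k) * F k (snd (1 / t, (1 / t) *\<^sub>R p) + v))"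
          unfolding eq F(2) by (simp add: mult.assoc[symmetric])
      qed
      ultimately show ?thesis using t(1) by simp
    qed
    then show ?thesis by blast
  qed
  then show ?thesis using that[of "F d"] F(1) dK by (auto simp: K_def)
qed

text \<open>Lines through points within distance 1 of \<open>z\<close> meet \<open>D\<close> only at
  parameters below \<open>m\<close>. Near \<open>z\<close> the sum is thus the sum of a closed set
  and a compact segment, which is closed.\<close>

lemma closed_line_sum_if_bounded:
  fixes D :: "'a::euclidean_space set"
  assumes "closed D"
    and bdd: "\<And>r. \<exists>m. \<forall>p t. norm p \<le> r \<longrightarrow> \<bar>t\<bar> \<ge> m \<longrightarrow> p + t *\<^sub>R v \<notin> D"
  shows "closed {z. \<exists>t. z + t *\<^sub>R v \<in> D}" (is "closed ?N")
proof -
  have "z \<in> ?N" if z: "z \<in> closure ?N" for z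
  proof -
    obtain m where m: "\<And>p t. norm p \<le> norm z + 1 \<Longrightarrow> \<bar>t\<bar> \<ge> m \<Longrightarrow> p + t *\<^sub>R v \<notin> D"
      using bdd by blast
    define N where "N = (\<Union>x\<in>D. \<Union>y\<in>(\<lambda>t. t *\<^sub>R v) ` {-m..m}. {x + y})"
    have "compact ((\<lambda>t. t *\<^sub>R v) ` {-m..m})"
      by (intro compact_continuous_image continuous_intros) auto
    then have "closed N" unfolding N_def using assms(1) by (rule closed_compact_sums[rotated])
    have "\<exists>w\<in>N. dist w z < e" if e: "e > 0" for e
    proof -
      have "min e 1 > 0" using e by simp
      then obtain w where w: "w \<in> ?N" "dist w z < min e 1"
        using z unfolding closure_approachable by blast
      then obtain t where t: "w + t *\<^sub>R v \<in> D" by blast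
      have "norm w \<le> norm z + 1"
        using w(2) norm_triangle_ineq2[of w z] by (simp add: dist_norm)
      then have "\<bar>t\<bar> < m" using m t by (meson not_less)
      then have "- t \<in> {-m..m}" by auto
      moreover have "w = (w + t *\<^sub>R v) + (- t) *\<^sub>R v" by simp
      ultimately have "w \<in> N" unfolding N_def using t by blast
      then show ?thesis using w(2) by auto
    qed
    then have "z \<in> closure N" unfolding closure_approachable by blast
    then have "z \<in> N" using \<open>closed N\<close> by simp
    then obtain x t where "x \<in> D" "z = x + t *\<^sub>R v" unfolding N_def by blast
    then have "z + (- t) *\<^sub>R v \<in> D" by simp
    then show ?thesis by blast
  qed
  then have "closure ?N \<subseteq> ?N" by (rule subsetI)
  then show ?thesis by (simp only: closure_subset_eq)
qed

lemma closed_line_sum_if_frontier: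
  fixes Y :: "'a::euclidean_space set"
  assumes "closed Y" and "closed {z. \<exists>t. z + t *\<^sub>R v \<in> frontier Y}" (is "closed ?N")
  shows "closed {z. \<exists>t. z + t *\<^sub>R v \<in> Y}"
proof -
  have "\<exists>e>0. ball z e \<subseteq> - {z. \<exists>t. z + t *\<^sub>R v \<in> Y}" if z: "\<And>t. z + t *\<^sub>R v \<notin> Y" for z
  proof -
    have "z \<in> - ?N" using z frontier_subset_closed[OF assms(1)] by auto
    then obtain e where e: "e > 0" "ball z e \<subseteq> - ?N"
      using assms(2) by (meson open_Compl open_contains_ball)
    define K where "K = (\<lambda>(w, s). w + s *\<^sub>R v) ` (ball z e \<times> (UNIV :: real set))"
    have "convex K" unfolding K_def
      by (intro convex_linear_image convex_Times) (auto simp: linear_iff algebra_simps)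
    have mem: "w + s *\<^sub>R v \<in> K" if "w \<in> ball z e" for w s
      using that unfolding K_def by force
    have "K \<inter> frontier Y = {}" using e(2) unfolding K_def by fastforce
    moreover have "K - Y \<noteq> {}" using mem[of z 0] z[of 0] e(1) by auto
    ultimately have "K \<inter> Y = {}"
      using connected_Int_frontier[of K Y] \<open>convex K\<close> convex_connected by blast
    then show ?thesis using mem e(1) by blast
  qed
  then have "open (- {z. \<exists>t. z + t *\<^sub>R v \<in> Y})" unfolding open_contains_ball by simp
  then show ?thesis by (simp add: closed_def)
qed

lemma closed_line_sum_generic:
  fixes Y :: "'a::euclidean_space set"
  assumes "closed Y" "semialgebraic Y" "e > 0"
  shows "\<exists>v. dist v v0 < e \<and> closed {z. \<exists>t. z + t *\<^sub>R v \<in> Y}"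
proof -
  obtain f x0 where f: "f \<in> poly_fun" "f x0 \<noteq> 0" "frontier Y \<subseteq> {x. f x = 0}"
    using frontier_semialgebraic_subset_zeros[OF assms(2)] by blast
  obtain h y where h: "h \<in> poly_fun" "h y \<noteq> 0"
    "\<And>v r. h v \<noteq> 0 \<Longrightarrow> \<exists>m. \<forall>p t. norm p \<le> r \<longrightarrow> \<bar>t\<bar> \<ge> m \<longrightarrow> f (p + t *\<^sub>R v) \<noteq> 0"
    using poly_fun_leading_form[OF f(1,2)] by metis
  \<comment> \<open>The leading form is a nonzero polynomial, so it cannot vanish on the whole ball
    around \<open>v0\<close>.\<close>
  obtain v where v: "v \<in> ball v0 e" "h v \<noteq> 0"
    using poly_fun_eq_0_if_open[OF h(1), of "ball v0 e" v0 y] h(2) assms(3) by auto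
  have "closed {z. \<exists>t. z + t *\<^sub>R v \<in> frontier Y}"
  proof (rule closed_line_sum_if_bounded)
    show "\<exists>m. \<forall>p t. norm p \<le> r \<longrightarrow> \<bar>t\<bar> \<ge> m \<longrightarrow> p + t *\<^sub>R v \<notin> frontier Y" for r
      using h(3)[OF v(2), of r] f(3) by blast
  qed simp
  then have "closed {z. \<exists>t. z + t *\<^sub>R v \<in> Y}" by (rule closed_line_sum_if_frontier[OF assms(1)])
  then show ?thesis using v(1) by (metis mem_ball dist_commute)
qed

text \<open>Each direction is perturbed only after the earlier ones are fixed: the sum obtained so
  far is closed by induction and semialgebraic by elimination, so it can take the role of
  \<open>Y\<close>.\<close>

lemma closed_span_sum_generic:
  fixes Y :: "'a::euclidean_space set" and v0 :: "'i \<Rightarrow> 'a"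
  assumes "closed Y" "semialgebraic Y" "e > 0" "finite I"
  shows "\<exists>v. (\<forall>i\<in>I. dist (v i) (v0 i) < e) \<and> closed {z. \<exists>c. z + (\<Sum>i\<in>I. c i *\<^sub>R v i) \<in> Y}"
  using assms(4)
proof induction
  case empty
  then show ?case using assms(1) by simp
next
  case (insert j I)
  then obtain v where v: "\<forall>i\<in>I. dist (v i) (v0 i) < e" "closed {z. \<exists>c. z + (\<Sum>i\<in>I. c i *\<^sub>R v i) \<in> Y}"
    by blast
  obtain w where w: "dist w (v0 j) < e"
      "closed {z. \<exists>t. z + t *\<^sub>R w \<in> {z. \<exists>c. z + (\<Sum>i\<in>I. c i *\<^sub>R v i) \<in> Y}}"
    using closed_line_sum_generic[OF v(2) semialgebraic_span_sum[OF insert.hyps(1) assms(2)] assms(3)]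
    by blast
  define v' where "v' = v(j := w)"
  have v': "v' j = w" "\<And>i. i \<in> I \<Longrightarrow> v' i = v i" using insert.hyps by (auto simp: v'_def)
  then have "(\<Sum>i\<in>I. c i *\<^sub>R v' i) = (\<Sum>i\<in>I. c i *\<^sub>R v i)" for c by (intro sum.cong) auto
  then have "closed {z. \<exists>c. z + (\<Sum>i\<in>insert j I. c i *\<^sub>R v' i) \<in> Y}"
    using w(2) unfolding add_span_insert_eq[OF insert.hyps(1,2)] v'(1) by simp
  moreover have "\<forall>i\<in>insert j I. dist (v' i) (v0 i) < e" using v(1) w(1) v' by auto
  ultimately show ?case by blast
qed

section \<open>From perturbed directions to perturbed matrices\<close>

lemma norm_matrix_le:
  fixes A :: "real^'n^'m"
  assumes "\<And>j. norm (A *v axis j 1) \<le> B"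
  shows "norm A \<le> real CARD('m) * (real CARD('n) * B)"
proof -
  have ij: "\<bar>A $ i $ j\<bar> \<le> B" for i j
    using assms[of j] component_le_norm_cart[of "A *v axis j 1" i]
    by (simp add: matrix_vector_mult_basis column_def)
  have "norm A \<le> (\<Sum>i\<in>UNIV. norm (A $ i))"
    unfolding norm_vec_def[of A] by (rule L2_set_le_sum) simp
  also have "\<dots> \<le> (\<Sum>i\<in>(UNIV :: 'm set). \<Sum>j\<in>(UNIV :: 'n set). B)"
    by (intro sum_mono order_trans[OF norm_le_l1_cart] ij)
  finally show ?thesis by simp
qed

lemma norm_vec_combination_le:
  fixes a :: "'n::finite \<Rightarrow> 'a::real_normed_vector"
  assumes "\<And>i. norm (a i) \<le> d"
  shows "norm (\<Sum>i\<in>UNIV. (c :: real^'n) $ i *\<^sub>R a i) \<le> real CARD('n) * d * norm c"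
proof -
  have "norm (\<Sum>i\<in>UNIV. c $ i *\<^sub>R a i) \<le> (\<Sum>i\<in>UNIV. norm (c $ i *\<^sub>R a i))" by (rule norm_sum)
  also have "\<dots> \<le> (\<Sum>i\<in>(UNIV :: 'n set). norm c * d)"
    using assms by (intro sum_mono) (auto intro!: mult_mono component_le_norm_cart)
  finally show ?thesis by (simp add: mult_ac)
qed

text \<open>The vectors \<open>(axis i 1, - (F0 *v axis i 1))\<close> span the kernel of
  \<open>(x, y) \<mapsto> F0 *v x + y\<close>. Perturbed ones span the vectors
  \<open>(u c, w c)\<close> with \<open>u\<close> near the identity and \<open>w\<close> near
  \<open>- F0\<close>; this is the graph of \<open>- F\<close> for \<open>F\<close> the negative of
  \<open>w\<close> composed with the inverse of \<open>u\<close>.\<close>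

lemma closed_linear_image_dense:
  fixes Y :: "((real^'n) \<times> (real^'m)) set"
  assumes "closed Y" "semialgebraic Y" "e > 0"
  shows "\<exists>F. dist F F0 < e \<and> closed ((\<lambda>(x, y). F *v x + y) ` Y)"
proof -
  obtain B where B: "B > 0" "\<And>x. norm (F0 *v x) \<le> B * norm x"
    using linear_bounded_pos[of "(*v) F0"] by (auto simp: mult.commute)
  define N where "N = real CARD('n)"
  define M where "M = real CARD('m)"
  have NM: "N > 0" "M > 0" by (auto simp: N_def M_def)
  \<comment> \<open>The first bound keeps \<open>u\<close> within 1/2 of the identity, hence
    invertible; the second makes the final estimate for the distance of \<open>F\<close> and
    \<open>F0\<close> at most \<open>e / 2\<close>.\<close>
  define \<delta> where "\<delta> = min (1 / (2 * N)) (e / (4 * M * N * N * (1 + B)))"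
  have \<delta>: "\<delta> > 0" "N * \<delta> \<le> 1 / 2" "M * (N * (2 * (1 + B) * (N * \<delta>))) < e"
  proof -
    show "\<delta> > 0" using NM B(1) assms(3) by (simp add: \<delta>_def)
    have "\<delta> \<le> 1 / (2 * N)" by (simp add: \<delta>_def)
    then show "N * \<delta> \<le> 1 / 2" using NM by (simp add: field_simps)
    have "\<delta> \<le> e / (4 * M * N * N * (1 + B))" by (simp add: \<delta>_def)
    then have "\<delta> * (4 * M * N * N * (1 + B)) \<le> e" using NM B(1) by (simp add: pos_le_divide_eq)
    moreover have "M * (N * (2 * (1 + B) * (N * \<delta>))) = \<delta> * (4 * M * N * N * (1 + B)) / 2"
      by (simp add: algebra_simps)
    ultimately show "M * (N * (2 * (1 + B) * (N * \<delta>))) < e" using assms(3) by linarith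
  qed
  obtain v :: "'n \<Rightarrow> (real^'n) \<times> (real^'m)" where
      v: "\<forall>i\<in>UNIV. dist (v i) (axis i 1, - (F0 *v axis i 1)) < \<delta>"
        "closed {z. \<exists>c. z + (\<Sum>i\<in>UNIV. c i *\<^sub>R v i) \<in> Y}"
    using closed_span_sum_generic[OF assms(1,2) \<delta>(1) finite[of UNIV],
        of "\<lambda>i. (axis i 1, - (F0 *v axis i 1))"] by blast
  define u where "u c = (\<Sum>i\<in>UNIV. c $ i *\<^sub>R fst (v i))" for c
  define w where "w c = (\<Sum>i\<in>UNIV. c $ i *\<^sub>R snd (v i))" for c
  have lin: "linear u" "linear w"
    by (auto simp: linear_iff u_def w_def sum.distrib scaleR_add_left scaleR_sum_right)
  have expand: "c = (\<Sum>i\<in>UNIV. c $ i *\<^sub>R axis i 1)" for c :: "real^'n"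
    using basis_expansion[of c] by (simp add: scalar_mult_eq_scaleR)
  have u_near: "norm (u c - c) \<le> N * \<delta> * norm c" for c
  proof -
    have "norm (fst (v i) - axis i 1) \<le> \<delta>" for i
      using v(1) dist_fst_le[of "v i" "(axis i 1, - (F0 *v axis i 1))"]
      by (force simp: dist_norm intro: order_trans less_imp_le)
    then have "norm (\<Sum>i\<in>UNIV. c $ i *\<^sub>R (fst (v i) - axis i 1)) \<le> N * \<delta> * norm c"
      unfolding N_def by (rule norm_vec_combination_le)
    moreover have "u c - c = (\<Sum>i\<in>UNIV. c $ i *\<^sub>R (fst (v i) - axis i 1))"
      by (subst (2) expand) (simp add: u_def scaleR_diff_right sum_subtractf)
    ultimately show ?thesis by simp
  qed
  have w_near: "norm (w c + F0 *v c) \<le> N * \<delta> * norm c" for c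
  proof -
    have "norm (snd (v i) + F0 *v axis i 1) \<le> \<delta>" for i
      using v(1) dist_snd_le[of "v i" "(axis i 1, - (F0 *v axis i 1))"]
      by (force simp: dist_norm intro: order_trans less_imp_le)
    then have "norm (\<Sum>i\<in>UNIV. c $ i *\<^sub>R (snd (v i) + F0 *v axis i 1)) \<le> N * \<delta> * norm c"
      unfolding N_def by (rule norm_vec_combination_le)
    moreover have "F0 *v c = (\<Sum>i\<in>UNIV. c $ i *\<^sub>R (F0 *v axis i 1))"
      by (subst expand) (simp add: linear_sum linear_scale)
    then have "w c + F0 *v c = (\<Sum>i\<in>UNIV. c $ i *\<^sub>R (snd (v i) + F0 *v axis i 1))"
      by (simp add: w_def scaleR_add_right sum.distrib)
    ultimately show ?thesis by simp
  qed
  have u_lower: "norm c \<le> 2 * norm (u c)" for c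
  proof -
    have "N * \<delta> * norm c \<le> 1 / 2 * norm c" using \<delta>(2) by (intro mult_right_mono) auto
    then show ?thesis using u_near[of c] norm_triangle_ineq2[of c "u c"] by (simp add: norm_minus_commute)
  qed
  have "inj u" unfolding linear_injective_0[OF lin(1)] using u_lower
    by (metis mult_zero_right norm_le_zero_iff norm_zero)
  then obtain u' where u': "linear u'" "\<And>x. u' (u x) = x" "\<And>x. u (u' x) = x"
    using linear_injective_isomorphism[OF lin(1)] by auto
  define F where "F = matrix (\<lambda>y. - w (u' y))"
  have "linear (\<lambda>y. - w (u' y))"
    using lin(2) u'(1) by (simp add: linear_iff)
  then have F: "F *v y = - w (u' y)" for y by (simp add: F_def matrix_works)
  have F_near: "norm ((F - F0) *v y) \<le> 2 * (1 + B) * (N * \<delta>) * norm y" for y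
  proof -
    let ?c = "u' y"
    \<comment> \<open>With \<open>y = u ?c\<close> and \<open>F *v y = - w ?c\<close>, the
      difference splits into the error of \<open>w\<close> and the image under \<open>F0\<close> of
      the error of \<open>u\<close>.\<close>
    have "(F - F0) *v y = - (w ?c + F0 *v ?c) - F0 *v (u ?c - ?c)"
      by (simp add: F u'(3) matrix_vector_mult_diff_rdistrib matrix_vector_mult_diff_distrib)
    then have "norm ((F - F0) *v y) \<le> norm (w ?c + F0 *v ?c) + norm (F0 *v (u ?c - ?c))"
      using norm_triangle_ineq4[of "- (w ?c + F0 *v ?c)" "F0 *v (u ?c - ?c)"] by (simp only: norm_minus_cancel)
    also have "\<dots> \<le> N * \<delta> * norm ?c + B * (N * \<delta> * norm ?c)"
      using w_near[of ?c] B(2)[of "u ?c - ?c"] mult_left_mono[OF u_near[of ?c], of B] B(1) by linarith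
    also have "\<dots> = (1 + B) * (N * \<delta>) * norm ?c" by (simp add: algebra_simps)
    also have "\<dots> \<le> (1 + B) * (N * \<delta>) * (2 * norm y)"
      using u_lower[of ?c] B(1) NM(1) \<delta>(1) by (intro mult_left_mono) (auto simp: u'(3))
    finally show ?thesis by (simp add: mult_ac)
  qed
  have "norm (F - F0) \<le> M * (N * (2 * (1 + B) * (N * \<delta>)))"
    unfolding M_def N_def using F_near[unfolded N_def] by (intro norm_matrix_le) (metis mult.right_neutral norm_axis_1)
  then have "dist F F0 < e" using \<delta>(3) by (simp add: dist_norm)
  \<comment> \<open>A point \<open>(0, q)\<close> lies in the sum iff a shift along the graph of
    \<open>- F\<close> takes it to some \<open>(x, y)\<close> in \<open>Y\<close>, that is, iff
    \<open>q = F *v x + y\<close>.\<close>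
  moreover have "(\<lambda>(x, y). F *v x + y) ` Y = (\<lambda>q. (0, q)) -` {z. \<exists>c. z + (\<Sum>i\<in>UNIV. c i *\<^sub>R v i) \<in> Y}"
  proof -
    have sum: "(\<Sum>i\<in>UNIV. c i *\<^sub>R v i) = (u (\<chi> i. c i), w (\<chi> i. c i))" for c
      by (simp add: prod_eq_iff fst_sum snd_sum u_def w_def)
    have "(\<exists>c. (0, q) + (\<Sum>i\<in>UNIV. c i *\<^sub>R v i) \<in> Y) \<longleftrightarrow> (\<exists>x y. (x, y) \<in> Y \<and> q = F *v x + y)" for q
    proof
      assume "\<exists>c. (0, q) + (\<Sum>i\<in>UNIV. c i *\<^sub>R v i) \<in> Y"
      then obtain c where "(u (\<chi> i. c i), q + w (\<chi> i. c i)) \<in> Y" by (auto simp: sum)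
      moreover have "q = F *v u (\<chi> i. c i) + (q + w (\<chi> i. c i))" by (simp add: F u'(2))
      ultimately show "\<exists>x y. (x, y) \<in> Y \<and> q = F *v x + y" by blast
    next
      assume "\<exists>x y. (x, y) \<in> Y \<and> q = F *v x + y"
      then obtain x y where xy: "(x, y) \<in> Y" "q = F *v x + y" by blast
      have "(\<chi> i. u' x $ i) = u' x" by (simp add: vec_eq_iff)
      then have "(0, q) + (\<Sum>i\<in>UNIV. u' x $ i *\<^sub>R v i) = (x, y)"
        by (simp add: sum u'(3) xy(2) F)
      then show "\<exists>c. (0, q) + (\<Sum>i\<in>UNIV. c i *\<^sub>R v i) \<in> Y" using xy(1) by metis
    qed
    then show ?thesis by (auto simp: image_iff Bex_def)
  qed
  then have "closed ((\<lambda>(x, y). F *v x + y) ` Y)"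
    using closed_vimage[OF v(2), of "\<lambda>q. (0, q)"] by (simp add: continuous_intros)
  ultimately show ?thesis by blast
qed

text \<open>The pairs \<open>(F, q)\<close> with \<open>q\<close> in the image are a projection of a
  set defined by \<open>Y\<close> and equations bilinear in \<open>F\<close> and \<open>x\<close>.
  The image is the fibre over \<open>F\<close>, and closedness of fibres is a semialgebraic
  condition.\<close>

lemma semialgebraic_closed_linear_image:
  fixes Y :: "((real^'n) \<times> (real^'m)) set"
  assumes "semialgebraic Y"
  shows "semialgebraic {F. closed ((\<lambda>(x, y). F *v x + y) ` Y)}"
proof -
  let ?U = "\<lambda>p :: ((real^'n^'m) \<times> (real^'m)) \<times> ((real^'n) \<times> (real^'m)).
    snd (fst p) - (fst (fst p) *v fst (snd p) + snd (snd p))"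
  have "(\<lambda>p. \<Sum>i\<in>UNIV. (snd (fst p) $ i - ((\<Sum>j\<in>UNIV. fst (fst p) $ i $ j * fst (snd p) $ j)
      + snd (snd p) $ i))\<^sup>2) \<in> poly_fun"
    by (intro poly_fun_sum poly_fun_power poly_fun_diff poly_fun.add poly_fun.mult poly_fun_linear)
       (auto simp: linear_iff)
  then have "(\<lambda>p. \<Sum>i\<in>UNIV. (?U p $ i)\<^sup>2) \<in> poly_fun"
    by (simp add: matrix_vector_mult_def)
  then have "semialgebraic {p. (\<Sum>i\<in>UNIV. (?U p $ i)\<^sup>2) = 0}"
    by (rule semialgebraic_zero)
  moreover have "(\<Sum>i\<in>UNIV. (?U p $ i)\<^sup>2) = 0 \<longleftrightarrow> snd (fst p) = fst (fst p) *v fst (snd p) + snd (snd p)" for p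
    by (subst sum_nonneg_eq_0_iff) (auto simp: vec_eq_iff)
  moreover have "semialgebraic {p :: ((real^'n^'m) \<times> (real^'m)) \<times> ((real^'n) \<times> (real^'m)). snd p \<in> Y}"
    using assms by (intro semialgebraic_vimage poly_map_linear) (auto simp: linear_iff)
  ultimately have "semialgebraic {p :: ((real^'n^'m) \<times> (real^'m)) \<times> ((real^'n) \<times> (real^'m)).
      snd p \<in> Y \<and> snd (fst p) = fst (fst p) *v fst (snd p) + snd (snd p)}"
    by (intro semialgebraic_Collect_conj) simp_all
  then have "semialgebraic {r :: (real^'n^'m) \<times> (real^'m). \<exists>z. z \<in> Y \<and> snd r = fst r *v fst z + snd z}"
    by (intro semialgebraic_Collect_ex) (simp add: case_prod_unfold)
  from semialgebraic_fibrewise_closed[OF this]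
  show ?thesis by (simp add: image_def case_prod_unfold Bex_def)
qed

text \<open>A point off the frontier of a dense set is an interior point, so the complement of a
  zero set containing the frontier is enough; it is dense since a nonzero polynomial vanishes on no
  nonempty open set.\<close>

lemma dense_semialgebraic_contains_open_dense:
  assumes "semialgebraic S" "closure S = UNIV"
  shows "\<exists>U. semialgebraic U \<and> open U \<and> closure U = UNIV \<and> U \<subseteq> S"
proof -
  obtain f a where f: "f \<in> poly_fun" "f a \<noteq> 0" "frontier S \<subseteq> {x. f x = 0}"
    using frontier_semialgebraic_subset_zeros[OF assms(1)] by blast
  let ?U = "{x. f x \<noteq> 0}"
  have "semialgebraic ?U" by (intro semialgebraic_Collect_not semialgebraic_zero f(1))
  moreover have "open ?U"
    using continuous_on_poly_fun[OF f(1)] by (intro open_Collect_neq) auto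
  moreover have "interior (- ?U) = {}"
    using poly_fun_eq_0_if_open[OF f(1) open_interior, of _ "- ?U" a] f(2) interior_subset by blast
  then have "closure ?U = UNIV" by (simp add: closure_interior)
  moreover have "?U \<subseteq> S"
    using f(3) assms(2) interior_subset by (auto simp: frontier_def)
  ultimately show ?thesis by blast
qed

theorem mainTheorem1:
  fixes X :: "(real^'n) set" and G :: "real^'n \<Rightarrow> real^'m"
  assumes "closed X" and "semialgebraic X"
    and "continuous_on X G" and "semialgebraic_map X G"
  shows "semialgebraic {F :: real^'n^'m. closed ((\<lambda>x. F *v x + G x) ` X)} \<and>
         (\<exists>U :: (real^'n^'m) set. semialgebraic U \<and> open U \<and> closure U = UNIV \<and>
            U \<subseteq> {F. closed ((\<lambda>x. F *v x + G x) ` X)})"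
proof -
  define Y where "Y = {(x, G x) | x. x \<in> X}"
  have Y: "semialgebraic Y" using assms(4) by (simp add: semialgebraic_map_def Y_def)
  have "closed {z \<in> X \<times> UNIV. snd z - G (fst z) = 0}"
    by (intro continuous_closed_preimage_constant closed_Times assms(1) closed_UNIV
        continuous_intros continuous_on_compose2[OF assms(3)]) auto
  also have "{z \<in> X \<times> UNIV. snd z - G (fst z) = 0} = Y" by (auto simp: Y_def)
  finally have "closed Y" .
  have img: "(\<lambda>x. F *v x + G x) ` X = (\<lambda>(x, y). F *v x + y) ` Y" for F
    by (force simp: Y_def)
  let ?S = "{F :: real^'n^'m. closed ((\<lambda>x. F *v x + G x) ` X)}"
  have S: "semialgebraic ?S" unfolding img using semialgebraic_closed_linear_image[OF Y] .
  have "F0 \<in> closure ?S" for F0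
    unfolding closure_approachable img using closed_linear_image_dense[OF \<open>closed Y\<close> Y] by blast
  then have "closure ?S = UNIV" by blast
  then show ?thesis using S dense_semialgebraic_contains_open_dense[OF S] by blast
qed

end
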